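(* Let $\eta\in L^\infty(\mathbb T)$ be a nonnegative function with $\int_{\mathbb T}\log\eta\,dm>-\infty$, and let $\mathcal O_\eta$ be the outer function $$\mathcal O_\eta(z)=\exp\left\{\int_{\mathbb T}\frac{\zeta+z}{\zeta-z}\log\eta(\zeta)\,dm(\zeta)\right\},\qquad z\in\mathbb D.$$ Then $\mathcal O_\eta$ is $G$-extremal if and only if there exists a sequence $\{z_n\}\subset\mathbb D$ such that $\mathcal P\eta(z_n)\to\|\eta\|_\infty$ and $\mathcal P\left(\log\frac1\eta\right)(z_n)\to\infty$.
   Context: $\mathbb D=\{z\in\mathbb C:|z|<1\}$, $\mathbb T=\partial\mathbb D$, $m$ is normalized arc length measure on $\mathbb T$, $L^p=L^p(\mathbb T,m)$. For $f\in L^1$, the Poisson integral is $\mathcal Pf(z)=\int_{\mathbb T}f(\zeta)\frac{1-|z|^2}{|\zeta-z|^2}\,dm(\zeta)$, $z\in\mathbb D$. $H^\infty$ is the set of $f\in L^\infty$ with $\mathcal Pf$ analytic on $\mathbb D$; such $f$ is identified with its analytic extension $\mathcal Pf$ (and bounded analytic functions on $\mathbb D$ are identified with their nontangential boundary values on $\mathbb T$). Under the hypotheses, $\mathcal O_\eta\in H^\infty$ and $|\mathcal O_\eta|=\eta$ a.e. on $\mathbb T$. For $f\in L^2$ put $\Phi_f(z)=\mathcal P(|f|^2)(z)-|\mathcal Pf(z)|^2$, $z\in\mathbb D$, and $\|f\|_G=\sup_{z\in\mathbb D}\Phi_f(z)^{1/2}$ (the Garsia norm). A function $f\in L^\infty$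 is called $G$-extremal if $\|f\|_G=\|f\|_\infty$ (in general $\|f\|_G\le\|f\|_\infty$). *)

theory Defs
  imports "HOL-Complex_Analysis.Complex_Analysis" "HOL-Probability.Probability"
begin

(* Normalized arc length measure on the unit circle: the image of the uniform distribution
   on [0, 2 pi) under t |-> exp (i t).  Its space is the circle, with the Borel sigma-algebra. *)
definition circle_measure :: "complex measure" where
  "circle_measure =
     distr (uniform_measure lborel {0..<2 * pi}) (restrict_space borel (sphere 0 1)) cis"

lemma measurable_cis_circle [measurable]:
  "cis \<in> borel \<rightarrow>\<^sub>M restrict_space borel (sphere 0 1)"
proof -
  have "cis \<in> borel \<rightarrow>\<^sub>M borel"
    by (intro borel_measurable_continuous_onI continuous_intros)
  then show ?thesis
    by (intro measurable_restrict_space2) auto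
qed

lemma space_circle_measure [simp]: "space circle_measure = sphere 0 1"
  by (simp add: circle_measure_def space_restrict_space)

lemma prob_space_circle_measure: "prob_space circle_measure"
proof -
  have "prob_space (uniform_measure lborel {0..<2 * pi})"
    by (rule prob_space_uniform_measure) auto
  then show ?thesis
    unfolding circle_measure_def by (rule prob_space.prob_space_distr) simp
qed

(* Elements of the spaces L^p are represented by Borel functions on the circle. The norm takes
   values in the extended reals, and is infinite outside L^infinity. *)
definition Linf_norm :: "(complex \<Rightarrow> 'a::real_normed_vector) \<Rightarrow> ereal" where
  "Linf_norm f = esssup circle_measure (\<lambda>\<zeta>. ereal (norm (f \<zeta>)))"

definition in_Linf :: "(complex \<Rightarrow> 'a::real_normed_vector) \<Rightarrow> bool" where
  "in_Linf f \<longleftrightarrow> f \<in> borel_measurable circle_measure \<and> Linf_norm f < \<infinity>"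

definition poisson_integral ::
  "(complex \<Rightarrow> 'a::{banach, second_countable_topology}) \<Rightarrow> complex \<Rightarrow> 'a" where
  "poisson_integral f z =
     (LINT \<zeta>|circle_measure. ((1 - (cmod z)\<^sup>2) / (cmod (\<zeta> - z))\<^sup>2) *\<^sub>R f \<zeta>)"

definition in_Hinf :: "(complex \<Rightarrow> complex) \<Rightarrow> bool" where
  "in_Hinf f \<longleftrightarrow> in_Linf f \<and> poisson_integral f holomorphic_on ball 0 1"

(* The identification of an element f of H^infinity, a function on the circle, with an analytic
   function F on the disc.  Given F, such an f is unique up to null sets. *)
definition boundary_function_of :: "(complex \<Rightarrow> complex) \<Rightarrow> (complex \<Rightarrow> complex) \<Rightarrow> bool" where
  "boundary_function_of f F \<longleftrightarrow> in_Hinf f \<and> (\<forall>z\<in>ball 0 1. poisson_integral f z = F z)"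

definition garsia_Phi :: "(complex \<Rightarrow> complex) \<Rightarrow> complex \<Rightarrow> real" where
  "garsia_Phi f z =
     poisson_integral (\<lambda>\<zeta>. (cmod (f \<zeta>))\<^sup>2) z - (cmod (poisson_integral f z))\<^sup>2"

definition garsia_norm :: "(complex \<Rightarrow> complex) \<Rightarrow> ereal" where
  "garsia_norm f = (SUP z\<in>ball 0 1. ereal (sqrt (garsia_Phi f z)))"

definition G_extremal :: "(complex \<Rightarrow> complex) \<Rightarrow> bool" where
  "G_extremal f \<longleftrightarrow> in_Linf f \<and> garsia_norm f = Linf_norm f"

(* G-extremality of a bounded analytic function on the disc, regarded as a function on the circle. *)
definition G_extremal_disc :: "(complex \<Rightarrow> complex) \<Rightarrow> bool" where
  "G_extremal_disc F \<longleftrightarrow> (\<exists>f. boundary_function_of f F \<and> G_extremal f)"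

(* Logarithm with log 0 = -infinity, whereas ln 0 = 0. *)
definition elog :: "real \<Rightarrow> ereal" where
  "elog x = (if 0 < x then ereal (ln x) else -\<infinity>)"

(* Integral with values in the extended reals.  It is only meaningful when one of the two
   terms is finite; for g = log eta with eta in L^infinity the first one is. *)
definition extended_integral :: "'a measure \<Rightarrow> ('a \<Rightarrow> ereal) \<Rightarrow> ereal" where
  "extended_integral M g =
     enn2ereal (\<integral>\<^sup>+x. e2ennreal (g x) \<partial>M) - enn2ereal (\<integral>\<^sup>+x. e2ennreal (- g x) \<partial>M)"

(* Used only for eta with log eta integrable, so that eta > 0 almost everywhere and the value
   of ln at 0 is irrelevant. *)
definition outer_function :: "(complex \<Rightarrow> real) \<Rightarrow> complex \<Rightarrow> complex" where
  "outer_function \<eta> z =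
     exp (LINT \<zeta>|circle_measure. (\<zeta> + z) / (\<zeta> - z) * of_real (ln (\<eta> \<zeta>)))"

end

theory Submission
  imports Defs
begin

text \<open>
  Let \<open>M\<close> be the essential supremum of \<open>\<eta>\<close> and let \<open>f\<close> be a boundary function of the outer
  function. Inside the disc the modulus of the outer function is the exponential of the Poisson
  integral of \<open>log \<eta>\<close>, and on the circle \<open>|f| = \<eta>\<close> almost everywhere. Hence the Garsia function is
  \<open>\<Phi> = Q - exp (-2L)\<close>, where \<open>Q\<close> and \<open>L\<close> are the Poisson integrals of \<open>\<eta>\<^sup>2\<close> and
  \<open>log (1/\<eta>)\<close>. With \<open>P\<close> the Poisson integral of \<open>\<eta>\<close>, positivity of the kernel and the
  Cauchy-Schwarz inequality give \<open>P\<^sup>2 \<le> Q \<le> M * P \<le> M\<^sup>2\<close>. So \<open>\<Phi> \<le> M\<^sup>2\<close>, and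
  \<open>\<Phi>\<close> comes arbitrarily close to \<open>M\<^sup>2\<close> along a sequence exactly when both \<open>Q\<close> tends to
  \<open>M\<^sup>2\<close>, which is the same as \<open>P\<close> tending to \<open>M\<close>, and \<open>exp (-2L)\<close> tends to 0
  (lemma \<open>outer_G_extremal_iff\<close>).

  The substance is the boundary behaviour that this computation presupposes: a boundary function
  must exist, and every boundary function must have modulus \<open>\<eta>\<close>. Both are obtained without
  nontangential maximal functions, from almost everywhere convergence along suitable sequences of
  radii only.

  Convergence: the Poisson means of an integrable function tend to it in \<open>L\<^sup>1\<close> as the radius
  tends to 1. They contract \<open>L\<^sup>1\<close>, so continuous functions suffice, and these are reached from all
  integrable functions by induction over Borel sets (\<open>radial_L1_limit_integrable\<close>). A subsequence
  then converges almost everywhere.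

  Existence: the dilations \<open>F (r * \<zeta>)\<close> of a bounded analytic function \<open>F\<close> are a Cauchy family in
  \<open>L\<^sup>2\<close> by Parseval's identity, so a sequence of them converges almost everywhere; the limit has
  Poisson integral \<open>F\<close> by dominated convergence (\<open>bounded_holomorphic_boundary_function\<close>).

  Modulus: along a common sequence of radii the Poisson means of \<open>f\<close> tend to \<open>f\<close> and those of
  \<open>log \<eta>\<close> tend to \<open>log \<eta>\<close>. The modulus of the former is the exponential of the latter,
  so \<open>|f| = \<eta>\<close> (\<open>outer_function_boundary_modulus\<close>).
\<close>

section \<open>Integration on the circle\<close>

interpretation circle: prob_space circle_measure
  by (rule prob_space_circle_measure)

lemma prob_circle [simp]: "circle.prob (sphere 0 1) = 1"
  using circle.prob_space by simp

lemma sets_circle_measure [measurable_cong]: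
  "sets circle_measure = sets (restrict_space borel (sphere 0 1))"
  by (simp add: circle_measure_def)

lemma measurable_circle_ident [measurable]: "(\<lambda>\<zeta>. \<zeta>) \<in> circle_measure \<rightarrow>\<^sub>M borel"
  by (subst measurable_cong_sets[OF sets_circle_measure refl])
     (intro measurable_restrict_space1, simp)

lemma measurable_circle_continuous:
  "continuous_on (sphere 0 1) f \<Longrightarrow> f \<in> borel_measurable circle_measure"
  by (subst measurable_cong_sets[OF sets_circle_measure refl])
     (rule borel_measurable_continuous_on_restrict)

lemma measurable_cnj [measurable]: "cnj \<in> borel_measurable borel"
  by (intro borel_measurable_continuous_onI continuous_intros)

lemma AE_circle_sphere: "AE \<zeta> in circle_measure. cmod \<zeta> = 1"
  by (rule AE_I2) simp

lemma integrable_bounded_mult_circle: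
  fixes k :: "complex \<Rightarrow> 'a::{real_normed_algebra, banach, second_countable_topology}"
  assumes k: "integrable circle_measure k" and [measurable]: "e \<in> borel_measurable circle_measure"
    and e: "\<And>\<zeta>. cmod \<zeta> = 1 \<Longrightarrow> norm (e \<zeta>) \<le> B"
  shows "integrable circle_measure (\<lambda>\<zeta>. e \<zeta> * k \<zeta>)"
proof (rule Bochner_Integration.integrable_bound)
  show "integrable circle_measure (\<lambda>\<zeta>. B * norm (k \<zeta>))"
    using k by simp
  show "(\<lambda>\<zeta>. e \<zeta> * k \<zeta>) \<in> borel_measurable circle_measure"
    using k by measurable
  show "AE \<zeta> in circle_measure. norm (e \<zeta> * k \<zeta>) \<le> norm (B * norm (k \<zeta>))"
    using AE_circle_sphere
  proof eventually_elim
    case (elim \<zeta>)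
    have "norm (e \<zeta> * k \<zeta>) \<le> norm (e \<zeta>) * norm (k \<zeta>)" by (rule norm_mult_ineq)
    also have "\<dots> \<le> B * norm (k \<zeta>)" using e[OF elim] by (rule mult_right_mono) simp
    also have "\<dots> \<le> norm (B * norm (k \<zeta>))" by simp
    finally show ?case .
  qed
qed

lemma circle_integral_eq:
  fixes f :: "complex \<Rightarrow> 'a::{banach, second_countable_topology}"
  assumes [measurable]: "f \<in> borel_measurable circle_measure"
  shows "(LINT \<zeta>|circle_measure. f \<zeta>) =
    (LINT t|lborel. indicator {0..2 * pi} t *\<^sub>R (1 / (2 * pi)) *\<^sub>R f (cis t))"
proof -
  have [measurable]: "f \<in> borel_measurable (restrict_space borel (sphere 0 1))"
    using assms by (subst measurable_cong_sets[OF sets_circle_measure[symmetric] refl])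
  have u: "uniform_measure lborel {0..<2 * pi} =
      density lborel (\<lambda>t. ennreal (indicator {0..<2 * pi} t / (2 * pi)))"
    unfolding uniform_measure_def
    by (rule arg_cong[where f = "density lborel"])
       (auto simp: fun_eq_iff indicator_def divide_ennreal[of 1 "2 * pi", simplified])
  have "(LINT \<zeta>|circle_measure. f \<zeta>) =
      (LINT t|uniform_measure lborel {0..<2 * pi}. f (cis t))"
    unfolding circle_measure_def by (rule integral_distr) (auto intro: measurable_cis_circle)
  also have "\<dots> = (LINT t|lborel. (indicator {0..<2 * pi} t / (2 * pi)) *\<^sub>R f (cis t))"
    unfolding u by (rule integral_density) auto
  also have "\<dots> = (LINT t|lborel. indicator {0..2 * pi} t *\<^sub>R (1 / (2 * pi)) *\<^sub>R f (cis t))"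
  proof (rule integral_cong_AE)
    show "AE t in lborel. (indicator {0..<2 * pi} t / (2 * pi)) *\<^sub>R f (cis t) =
        indicator {0..2 * pi} t *\<^sub>R (1 / (2 * pi)) *\<^sub>R f (cis t)"
      using AE_lborel_singleton[of "2 * pi"]
      by eventually_elim (auto simp: indicator_def)
  qed measurable
  finally show ?thesis .
qed

lemma circle_integral_power:
  assumes "n \<noteq> 0"
  shows "(LINT \<zeta>|circle_measure. \<zeta> ^ n) = 0"
proof -
  define F where "F = (\<lambda>t::real. of_real (1 / (2 * pi)) / (\<i> * of_nat n) * cis (n * t))"
  have "(LINT \<zeta>|circle_measure. \<zeta> ^ n) =
      (LINT t|lborel. indicator {0..2 * pi} t *\<^sub>R (1 / (2 * pi)) *\<^sub>R cis (n * t))"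
    by (subst circle_integral_eq) (auto simp: Complex.DeMoivre)
  also have "\<dots> = F (2 * pi) - F 0"
  proof (rule integral_FTC_Icc)
    fix t :: real
    have "((\<lambda>w. exp (\<i> * (of_nat n * w))) has_field_derivative
        exp (\<i> * (of_nat n * of_real t)) * (\<i> * of_nat n)) (at (complex_of_real t))"
      by (auto intro!: derivative_eq_intros)
    then have "((\<lambda>t. exp (\<i> * of_real (n * t))) has_vector_derivative
        exp (\<i> * of_real (n * t)) * (\<i> * of_nat n)) (at t within {0..2 * pi})"
      using has_vector_derivative_real_field[of "\<lambda>w. exp (\<i> * (of_nat n * w))" _ t "{0..2 * pi}"]
      by (simp add: has_field_derivative_at_within)
    from bounded_linear.has_vector_derivative[OF bounded_linear_mult_right this,
        of "of_real (1 / (2 * pi)) / (\<i> * of_nat n)"]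
    show "(F has_vector_derivative (1 / (2 * pi)) *\<^sub>R cis (n * t)) (at t within {0..2 * pi})"
      using assms
      by (simp add: F_def cis_conv_exp scaleR_conv_of_real field_simps)
  qed (auto intro!: continuous_intros)
  also have "\<dots> = 0"
    using cis_multiple_2pi[of n] by (simp add: F_def mult_ac)
  finally show ?thesis .
qed

lemma circle_orthogonality:
  "(LINT \<zeta>|circle_measure. \<zeta> ^ m * cnj \<zeta> ^ n) = (if m = n then 1 else 0)"
proof -
  have *: "(LINT \<zeta>|circle_measure. \<zeta> ^ m * cnj \<zeta> ^ n) = (LINT \<zeta>|circle_measure. \<zeta> ^ (m - n))" if "n \<le> m" for m n
  proof (rule Bochner_Integration.integral_cong)
    fix \<zeta> assume "\<zeta> \<in> space circle_measure"
    then have "\<zeta> * cnj \<zeta> = 1" by (simp flip: complex_norm_square)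
    moreover have "\<zeta> ^ m = \<zeta> ^ (m - n) * \<zeta> ^ n" using that by (simp flip: power_add)
    ultimately show "\<zeta> ^ m * cnj \<zeta> ^ n = \<zeta> ^ (m - n)"
      by (simp add: mult.assoc flip: power_mult_distrib)
  qed simp
  show ?thesis
  proof (cases "n \<le> m")
    case True
    then show ?thesis
      using *[OF True] circle_integral_power[of "m - n"] by (cases "m = n") (auto simp: circle.prob_space)
  next
    case False
    have "(LINT \<zeta>|circle_measure. \<zeta> ^ m * cnj \<zeta> ^ n) = cnj (LINT \<zeta>|circle_measure. \<zeta> ^ n * cnj \<zeta> ^ m)"
      unfolding Bochner_Integration.integral_cnj[symmetric] by (simp add: mult.commute)
    then show ?thesis
      using *[of m n] circle_integral_power[of "n - m"] False by simp
  qed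
qed

text \<open>All Fourier computations below come from this one interchange: the terms are dominated by
  \<open>|b n| * |k|\<close>, whose sum is integrable.\<close>
lemma circle_integral_series:
  fixes b :: "nat \<Rightarrow> complex" and k :: "complex \<Rightarrow> complex"
  assumes b: "summable (\<lambda>n. cmod (b n))"
    and e [measurable]: "\<And>n. e n \<in> borel_measurable circle_measure"
    and e1: "\<And>n \<zeta>. cmod \<zeta> = 1 \<Longrightarrow> cmod (e n \<zeta>) \<le> 1"
    and k: "integrable circle_measure k"
    and h: "\<And>\<zeta>. cmod \<zeta> = 1 \<Longrightarrow> (\<lambda>n. b n * e n \<zeta>) sums h \<zeta>"
  shows "(\<lambda>n. b n * (LINT \<zeta>|circle_measure. e n \<zeta> * k \<zeta>)) sums
    (LINT \<zeta>|circle_measure. h \<zeta> * k \<zeta>)"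
proof -
  have ek: "integrable circle_measure (\<lambda>\<zeta>. e n \<zeta> * k \<zeta>)" for n
    using k e e1 by (rule integrable_bounded_mult_circle)
  have bek: "cmod (b n * (e n \<zeta> * k \<zeta>)) \<le> cmod (b n) * cmod (k \<zeta>)" if "cmod \<zeta> = 1" for n \<zeta>
  proof -
    have "cmod (e n \<zeta>) * cmod (k \<zeta>) \<le> 1 * cmod (k \<zeta>)"
      using e1[OF that] by (intro mult_right_mono) auto
    then show ?thesis by (simp add: norm_mult mult_left_mono)
  qed
  have sk: "summable (\<lambda>n. cmod (b n) * cmod (k \<zeta>))" for \<zeta>
    using b by (rule summable_mult2)
  have "(\<lambda>n. LINT \<zeta>|circle_measure. b n * (e n \<zeta> * k \<zeta>)) sums
      (LINT \<zeta>|circle_measure. (\<Sum>n. b n * (e n \<zeta> * k \<zeta>)))"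
  proof (rule sums_integral)
    show "integrable circle_measure (\<lambda>\<zeta>. b n * (e n \<zeta> * k \<zeta>))" for n
      using ek by simp
    show "AE \<zeta> in circle_measure. summable (\<lambda>n. cmod (b n * (e n \<zeta> * k \<zeta>)))"
      using AE_circle_sphere
      by eventually_elim (rule summable_comparison_test'[OF sk], use bek in auto)
    show "summable (\<lambda>n. LINT \<zeta>|circle_measure. cmod (b n * (e n \<zeta> * k \<zeta>)))"
    proof (rule summable_comparison_test')
      show "summable (\<lambda>n. cmod (b n) * (LINT \<zeta>|circle_measure. cmod (k \<zeta>)))"
        using b by (rule summable_mult2)
      fix n
      have "norm (LINT \<zeta>|circle_measure. cmod (b n * (e n \<zeta> * k \<zeta>))) =
          (LINT \<zeta>|circle_measure. cmod (b n * (e n \<zeta> * k \<zeta>)))"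
        by simp
      also have "\<dots> \<le> (LINT \<zeta>|circle_measure. cmod (b n) * cmod (k \<zeta>))"
      proof (rule integral_mono)
        show "integrable circle_measure (\<lambda>\<zeta>. cmod (b n * (e n \<zeta> * k \<zeta>)))"
          using ek by (intro integrable_norm) auto
      qed (use k bek in auto)
      finally show "norm (LINT \<zeta>|circle_measure. cmod (b n * (e n \<zeta> * k \<zeta>))) \<le>
          cmod (b n) * (LINT \<zeta>|circle_measure. cmod (k \<zeta>))"
        by simp
    qed
  qed
  also have "(LINT \<zeta>|circle_measure. (\<Sum>n. b n * (e n \<zeta> * k \<zeta>))) = (LINT \<zeta>|circle_measure. h \<zeta> * k \<zeta>)"
  proof (rule Bochner_Integration.integral_cong)
    fix \<zeta> assume "\<zeta> \<in> space circle_measure"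
    then have "(\<lambda>n. b n * e n \<zeta> * k \<zeta>) sums (h \<zeta> * k \<zeta>)"
      using h by (intro sums_mult2) auto
    then show "(\<Sum>n. b n * (e n \<zeta> * k \<zeta>)) = h \<zeta> * k \<zeta>"
      by (simp add: sums_iff mult.assoc)
  qed simp
  finally show ?thesis by simp
qed

section \<open>Herglotz and Poisson kernels\<close>

lemma herglotz_kernel_bound:
  assumes "cmod \<zeta> = 1" "cmod z < 1"
  shows "cmod ((\<zeta> + z) / (\<zeta> - z)) \<le> 2 / (1 - cmod z)"
proof -
  have "cmod (\<zeta> + z) \<le> 2" "1 - cmod z \<le> cmod (\<zeta> - z)"
    using assms norm_triangle_ineq[of \<zeta> z] norm_triangle_ineq2[of \<zeta> z] by auto
  then show ?thesis using assms by (simp add: norm_divide frac_le)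
qed

text \<open>On the circle \<open>1/\<zeta>\<close> is \<open>cnj \<zeta>\<close>, so the kernel is \<open>(1 + w) / (1 - w)\<close> with
  \<open>w = z * cnj \<zeta>\<close>, that is, twice a geometric series minus 1.\<close>
lemma herglotz_kernel_sums:
  assumes \<zeta>: "cmod \<zeta> = 1" and z: "cmod z < 1"
  shows "(\<lambda>n. ((if n = 0 then 1 else 2) * z ^ n) * cnj \<zeta> ^ n) sums ((\<zeta> + z) / (\<zeta> - z))"
proof -
  define w where "w = z * cnj \<zeta>"
  have w: "cmod w < 1" using assms by (simp add: w_def norm_mult)
  have cc: "\<zeta> * cnj \<zeta> = 1" using \<zeta> by (simp flip: complex_norm_square)
  have "(\<lambda>n. 2 * w ^ n) sums (2 * (1 / (1 - w)))"
    using geometric_sums[OF w] by (rule sums_mult)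
  moreover have "(\<lambda>n. if n = 0 then 1 else 0 :: complex) sums 1"
    by (rule sums_single[of 0 "\<lambda>_. 1"])
  ultimately have "(\<lambda>n. 2 * w ^ n - (if n = 0 then 1 else 0)) sums (2 * (1 / (1 - w)) - 1)"
    by (rule sums_diff)
  also have "(\<lambda>n. 2 * w ^ n - (if n = 0 then 1 else 0)) =
      (\<lambda>n. ((if n = 0 then 1 else 2) * z ^ n) * cnj \<zeta> ^ n)"
    by (auto simp: fun_eq_iff w_def power_mult_distrib)
  also have "2 * (1 / (1 - w)) - 1 = (1 + w) / (1 - w)"
    using w by (cases "w = 1") (simp_all add: field_simps)
  also have "\<dots> = (\<zeta> * (1 + w)) / (\<zeta> * (1 - w))"
    using \<zeta> by auto
  also have "\<dots> = (\<zeta> + z) / (\<zeta> - z)"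
    using cc by (simp add: w_def ring_distribs mult.left_commute[of \<zeta> z])
  finally show ?thesis .
qed

lemma herglotz_coeff_summable:
  fixes z :: complex
  assumes "cmod z < 1"
  shows "summable (\<lambda>n. cmod ((if n = 0 then 1 else 2) * z ^ n))"
proof (rule summable_comparison_test')
  show "summable (\<lambda>n. 2 * cmod z ^ n)"
    using assms by (intro summable_mult summable_geometric) auto
qed (auto simp: norm_mult norm_power)

text \<open>The Herglotz integral of an integrable function is a power series in \<open>z\<close>, and hence is
  analytic; this is also how the outer function is seen to be analytic.\<close>
lemma herglotz_integral_sums:
  assumes "integrable circle_measure k" "cmod z < 1"
  shows "(\<lambda>n. ((if n = 0 then 1 else 2) * (LINT \<zeta>|circle_measure. cnj \<zeta> ^ n * k \<zeta>)) * z ^ n) sums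
    (LINT \<zeta>|circle_measure. (\<zeta> + z) / (\<zeta> - z) * k \<zeta>)"
proof -
  have "(\<lambda>n. ((if n = 0 then 1 else 2) * z ^ n) * (LINT \<zeta>|circle_measure. cnj \<zeta> ^ n * k \<zeta>)) sums
    (LINT \<zeta>|circle_measure. (\<zeta> + z) / (\<zeta> - z) * k \<zeta>)"
    using herglotz_coeff_summable[OF assms(2)] _ _ assms(1) herglotz_kernel_sums[OF _ assms(2)]
    by (rule circle_integral_series) (auto simp: norm_power)
  then show ?thesis by (simp add: mult_ac)
qed

text \<open>The weight in \<^const>\<open>poisson_integral\<close>, named so that its positivity, its symmetry and its
  total mass can be stated separately from the integrand.\<close>
definition poisson_kernel :: "complex \<Rightarrow> complex \<Rightarrow> real" where
  "poisson_kernel z \<zeta> = (1 - (cmod z)\<^sup>2) / (cmod (\<zeta> - z))\<^sup>2"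

lemma poisson_integral_kernel:
  "poisson_integral f z = (LINT \<zeta>|circle_measure. poisson_kernel z \<zeta> *\<^sub>R f \<zeta>)"
  by (simp add: poisson_integral_def poisson_kernel_def)

lemma poisson_kernel_Re:
  assumes "cmod \<zeta> = 1"
  shows "poisson_kernel z \<zeta> = Re ((\<zeta> + z) / (\<zeta> - z))"
proof -
  have "Re ((\<zeta> + z) * cnj (\<zeta> - z)) = (cmod \<zeta>)\<^sup>2 - (cmod z)\<^sup>2"
    by (simp only: cmod_power2) (simp add: algebra_simps power2_eq_square)
  then show ?thesis
    using assms by (simp add: poisson_kernel_def Re_complex_div_eq_0 complex_div_cnj[of "\<zeta> + z"]
        del: complex_cnj_diff flip: of_real_power)
qed

lemma poisson_kernel_nonneg: "cmod z < 1 \<Longrightarrow> 0 \<le> poisson_kernel z \<zeta>"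
  by (simp add: poisson_kernel_def abs_square_le_1)

lemma poisson_kernel_le:
  assumes "cmod \<zeta> = 1" "cmod z < 1"
  shows "poisson_kernel z \<zeta> \<le> 1 / (1 - cmod z)\<^sup>2"
proof -
  have "1 - cmod z \<le> cmod (\<zeta> - z)"
    using assms norm_triangle_ineq2[of \<zeta> z] by simp
  then have "(1 - cmod z)\<^sup>2 \<le> (cmod (\<zeta> - z))\<^sup>2"
    using assms by (intro power_mono) auto
  then show ?thesis
    unfolding poisson_kernel_def using assms by (intro frac_le) auto
qed

lemma measurable_poisson_kernel [measurable]:
  "(\<lambda>(z, \<zeta>). poisson_kernel z \<zeta>) \<in> borel_measurable (borel \<Otimes>\<^sub>M borel)"
  unfolding poisson_kernel_def by measurable

lemma integrable_poisson:
  fixes f :: "complex \<Rightarrow> 'a::{banach, second_countable_topology}"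
  assumes f: "integrable circle_measure f" and z: "cmod z < 1"
  shows "integrable circle_measure (\<lambda>\<zeta>. poisson_kernel z \<zeta> *\<^sub>R f \<zeta>)"
proof (rule Bochner_Integration.integrable_bound)
  show "integrable circle_measure (\<lambda>\<zeta>. (1 / (1 - cmod z)\<^sup>2) * norm (f \<zeta>))"
    using f by simp
  have [measurable]: "f \<in> borel_measurable circle_measure" using f by simp
  show "(\<lambda>\<zeta>. poisson_kernel z \<zeta> *\<^sub>R f \<zeta>) \<in> borel_measurable circle_measure"
    by measurable
  show "AE \<zeta> in circle_measure. norm (poisson_kernel z \<zeta> *\<^sub>R f \<zeta>) \<le>
      norm ((1 / (1 - cmod z)\<^sup>2) * norm (f \<zeta>))"
    using AE_circle_sphere
  proof eventually_elim
    case (elim \<zeta>)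
    have "poisson_kernel z \<zeta> * norm (f \<zeta>) \<le> (1 / (1 - cmod z)\<^sup>2) * norm (f \<zeta>)"
      using poisson_kernel_le[OF elim z] by (rule mult_right_mono) simp
    then show ?case using poisson_kernel_nonneg[OF z, of \<zeta>] by simp
  qed
qed

lemma poisson_integral_herglotz:
  fixes k :: "complex \<Rightarrow> real"
  assumes k: "integrable circle_measure k" and z: "cmod z < 1"
  shows "poisson_integral k z = Re (LINT \<zeta>|circle_measure. (\<zeta> + z) / (\<zeta> - z) * of_real (k \<zeta>))"
proof -
  have [measurable]: "k \<in> borel_measurable circle_measure" using k by simp
  have "integrable circle_measure (\<lambda>\<zeta>. (\<zeta> + z) / (\<zeta> - z) * of_real (k \<zeta>))"
  proof (rule integrable_bounded_mult_circle)
    show "cmod ((\<zeta> + z) / (\<zeta> - z)) \<le> 2 / (1 - cmod z)" if "cmod \<zeta> = 1" for \<zeta>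
      using that z by (rule herglotz_kernel_bound)
  qed (use k in auto)
  then have "Re (LINT \<zeta>|circle_measure. (\<zeta> + z) / (\<zeta> - z) * of_real (k \<zeta>)) =
      (LINT \<zeta>|circle_measure. Re ((\<zeta> + z) / (\<zeta> - z) * of_real (k \<zeta>)))"
    by (rule integral_Re[symmetric])
  also have "\<dots> = poisson_integral k z"
    unfolding poisson_integral_kernel
  proof (rule Bochner_Integration.integral_cong)
    fix \<zeta> assume "\<zeta> \<in> space circle_measure"
    then show "Re ((\<zeta> + z) / (\<zeta> - z) * of_real (k \<zeta>)) = poisson_kernel z \<zeta> *\<^sub>R k \<zeta>"
      by (simp only: times_complex.sel Re_complex_of_real Im_complex_of_real)
         (simp add: poisson_kernel_Re del: Re_divide)
  qed simp
  finally show ?thesis by simp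
qed

text \<open>The real part of the Herglotz kernel is half the sum of the kernel and its conjugate; for \<open>n > 0\<close>,
  orthogonality with \<open>\<zeta> ^ n\<close> picks the coefficient \<open>2 * z ^ n\<close> from the kernel and nothing from
  its conjugate, and for \<open>n = 0\<close> each contributes 1.\<close>
lemma poisson_integral_power:
  assumes z: "cmod z < 1"
  shows "poisson_integral (\<lambda>\<zeta>. \<zeta> ^ n) z = z ^ n"
proof -
  define H where "H = (\<lambda>\<zeta>. (\<zeta> + z) / (\<zeta> - z))"
  have [measurable]: "H \<in> borel_measurable circle_measure" unfolding H_def by measurable
  have H_bound: "cmod (H \<zeta>) \<le> 2 / (1 - cmod z)" if "cmod \<zeta> = 1" for \<zeta>
    unfolding H_def using that z by (rule herglotz_kernel_bound)
  have int: "integrable circle_measure (\<lambda>\<zeta>. \<zeta> ^ n)" "integrable circle_measure (\<lambda>\<zeta>. cnj \<zeta> ^ n)"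
    by (rule circle.integrable_const_bound[where B = 1]; auto simp: norm_power)+
  have intH: "integrable circle_measure (\<lambda>\<zeta>. H \<zeta> * \<zeta> ^ n)" "integrable circle_measure (\<lambda>\<zeta>. H \<zeta> * cnj \<zeta> ^ n)"
    using H_bound int by (auto intro!: integrable_bounded_mult_circle)
  have "(\<lambda>m. if m = n then (if m = 0 then 1 else 2) * z ^ m else 0) sums ((if n = 0 then 1 else 2) * z ^ n)"
    by (rule sums_single)
  also have "(\<lambda>m. if m = n then (if m = 0 then 1 else 2) * z ^ m else 0) =
      (\<lambda>m. ((if m = 0 then 1 else 2) * (LINT \<zeta>|circle_measure. cnj \<zeta> ^ m * \<zeta> ^ n)) * z ^ m)"
    using circle_orthogonality[of n] by (auto simp: fun_eq_iff mult.commute)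
  finally have 1: "(LINT \<zeta>|circle_measure. H \<zeta> * \<zeta> ^ n) = (if n = 0 then 1 else 2) * z ^ n"
    using herglotz_integral_sums[OF int(1) z] unfolding H_def by (rule sums_unique2[symmetric])
  have "(\<lambda>m. if m = 0 then (if n = 0 then 1 else 0) else 0) sums (if n = 0 then 1 else 0 :: complex)"
    by (rule sums_single)
  also have "(\<lambda>m. if m = 0 then (if n = 0 then 1 else 0) else 0) =
      (\<lambda>m. ((if m = 0 then 1 else 2) * (LINT \<zeta>|circle_measure. cnj \<zeta> ^ m * cnj \<zeta> ^ n)) * z ^ m)"
    using circle_orthogonality[of 0 "_ + n"] by (auto simp: fun_eq_iff power_add)
  finally have 2: "(LINT \<zeta>|circle_measure. H \<zeta> * cnj \<zeta> ^ n) = (if n = 0 then 1 else 0)"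
    using herglotz_integral_sums[OF int(2) z] unfolding H_def by (rule sums_unique2[symmetric])
  have "poisson_integral (\<lambda>\<zeta>. \<zeta> ^ n) z =
      (LINT \<zeta>|circle_measure. (H \<zeta> * \<zeta> ^ n + cnj (H \<zeta> * cnj \<zeta> ^ n)) / 2)"
    unfolding poisson_integral_kernel
  proof (rule Bochner_Integration.integral_cong)
    fix \<zeta> assume "\<zeta> \<in> space circle_measure"
    then have "complex_of_real (poisson_kernel z \<zeta>) = (H \<zeta> + cnj (H \<zeta>)) / 2"
      by (simp add: poisson_kernel_Re H_def complex_add_cnj del: Re_divide complex_cnj_divide)
    then show "poisson_kernel z \<zeta> *\<^sub>R \<zeta> ^ n = (H \<zeta> * \<zeta> ^ n + cnj (H \<zeta> * cnj \<zeta> ^ n)) / 2"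
      by (simp add: scaleR_conv_of_real algebra_simps add_divide_distrib)
  qed simp
  also have "\<dots> = ((LINT \<zeta>|circle_measure. H \<zeta> * \<zeta> ^ n) + cnj (LINT \<zeta>|circle_measure. H \<zeta> * cnj \<zeta> ^ n)) / 2"
    unfolding integral_divide_zero Bochner_Integration.integral_cnj[symmetric]
    by (subst Bochner_Integration.integral_add) (intro intH integrable_cnj refl)+
  also have "\<dots> = z ^ n" unfolding 1 2 by (auto simp: complex_eq_iff)
  finally show ?thesis .
qed

lemma integral_poisson_kernel:
  assumes "cmod z < 1"
  shows "(LINT \<zeta>|circle_measure. poisson_kernel z \<zeta>) = 1"
proof -
  have "complex_of_real (LINT \<zeta>|circle_measure. poisson_kernel z \<zeta>) = 1"
    using poisson_integral_power[OF assms, of 0]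
    by (simp add: poisson_integral_kernel scaleR_conv_of_real flip: integral_complex_of_real)
  then show ?thesis by simp
qed

section \<open>Radial Poisson means\<close>

text \<open>On the unit circle \<open>|\<zeta> - r\<xi>| = |\<xi> - r\<zeta>|\<close>. Thus the kernel has mass 1 also as a
  function of the direction \<open>\<xi>\<close> in which the mean is taken, and radial Poisson means contract \<open>L\<^sup>1\<close> by Tonelli's theorem.\<close>
lemma poisson_kernel_symmetric:
  assumes "cmod \<zeta> = 1" "cmod \<xi> = 1"
  shows "poisson_kernel (of_real r * \<xi>) \<zeta> = poisson_kernel (of_real r * \<zeta>) \<xi>"
proof -
  have *: "(Re \<zeta>)\<^sup>2 + (Im \<zeta>)\<^sup>2 = 1" "(Re \<xi>)\<^sup>2 + (Im \<xi>)\<^sup>2 = 1"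
    using assms by (simp_all flip: cmod_power2)
  have e: "(cmod (a - of_real r * b))\<^sup>2 =
      ((Re a)\<^sup>2 + (Im a)\<^sup>2) + r\<^sup>2 * ((Re b)\<^sup>2 + (Im b)\<^sup>2) - 2 * r * (Re a * Re b + Im a * Im b)" for a b
    by (simp only: cmod_power2) (simp add: algebra_simps power2_eq_square)
  show ?thesis
    unfolding poisson_kernel_def e * using assms by (simp add: norm_mult mult.commute)
qed

lemma measurable_poisson_integral_radial:
  fixes f :: "complex \<Rightarrow> 'a::{banach, second_countable_topology}"
  assumes [measurable]: "f \<in> borel_measurable circle_measure"
  shows "(\<lambda>\<xi>. poisson_integral f (of_real r * \<xi>)) \<in> borel_measurable circle_measure"
  unfolding poisson_integral_kernel
proof (rule circle.borel_measurable_lebesgue_integral)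
  show "(\<lambda>(\<xi>, \<zeta>). poisson_kernel (of_real r * \<xi>) \<zeta> *\<^sub>R f \<zeta>) \<in>
      borel_measurable (circle_measure \<Otimes>\<^sub>M circle_measure)"
    by measurable
qed

lemma nn_integral_poisson_kernel:
  assumes "cmod z < 1"
  shows "(\<integral>\<^sup>+\<zeta>. ennreal (poisson_kernel z \<zeta>) \<partial>circle_measure) = 1"
proof -
  have "integrable circle_measure (\<lambda>\<zeta>. poisson_kernel z \<zeta>)"
    using integrable_poisson[of "\<lambda>_. 1 :: real", OF _ assms] by simp
  then show ?thesis
    using assms by (subst nn_integral_eq_integral) (auto simp: poisson_kernel_nonneg integral_poisson_kernel)
qed

lemma poisson_integral_radial_nn_bound:
  fixes f :: "complex \<Rightarrow> 'a::{banach, second_countable_topology}"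
  assumes f: "integrable circle_measure f" and r: "0 \<le> r" "r < 1"
  shows "(\<integral>\<^sup>+\<xi>. ennreal (norm (poisson_integral f (of_real r * \<xi>))) \<partial>circle_measure) \<le>
    (\<integral>\<^sup>+\<zeta>. ennreal (norm (f \<zeta>)) \<partial>circle_measure)"
proof -
  have [measurable]: "f \<in> borel_measurable circle_measure" using f by simp
  interpret pair: pair_sigma_finite circle_measure circle_measure ..
  have inside: "cmod (of_real r * \<xi>) < 1" if "cmod \<xi> = 1" for \<xi>
    using that r by (simp add: norm_mult)
  have "(\<integral>\<^sup>+\<xi>. ennreal (norm (poisson_integral f (of_real r * \<xi>))) \<partial>circle_measure) \<le>
      (\<integral>\<^sup>+\<xi>. (\<integral>\<^sup>+\<zeta>. ennreal (norm (poisson_kernel (of_real r * \<xi>) \<zeta> *\<^sub>R f \<zeta>)) \<partial>circle_measure) \<partial>circle_measure)"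
    unfolding poisson_integral_kernel
    by (intro nn_integral_mono integral_norm_bound_ennreal integrable_poisson f inside) simp
  also have "\<dots> = (\<integral>\<^sup>+\<zeta>. (\<integral>\<^sup>+\<xi>. ennreal (norm (poisson_kernel (of_real r * \<xi>) \<zeta> *\<^sub>R f \<zeta>)) \<partial>circle_measure) \<partial>circle_measure)"
    by (rule pair.Fubini') measurable
  also have "\<dots> = (\<integral>\<^sup>+\<zeta>. ennreal (norm (f \<zeta>)) \<partial>circle_measure)"
  proof (rule nn_integral_cong)
    fix \<zeta> assume "\<zeta> \<in> space circle_measure"
    then have \<zeta>: "cmod \<zeta> = 1" by simp
    have "(\<integral>\<^sup>+\<xi>. ennreal (norm (poisson_kernel (of_real r * \<xi>) \<zeta> *\<^sub>R f \<zeta>)) \<partial>circle_measure) =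
        (\<integral>\<^sup>+\<xi>. ennreal (poisson_kernel (of_real r * \<zeta>) \<xi>) * ennreal (norm (f \<zeta>)) \<partial>circle_measure)"
    proof (rule nn_integral_cong)
      fix \<xi> assume "\<xi> \<in> space circle_measure"
      then have "poisson_kernel (of_real r * \<xi>) \<zeta> = poisson_kernel (of_real r * \<zeta>) \<xi>"
        using poisson_kernel_symmetric[OF \<zeta>] by simp
      then show "ennreal (norm (poisson_kernel (of_real r * \<xi>) \<zeta> *\<^sub>R f \<zeta>)) =
          ennreal (poisson_kernel (of_real r * \<zeta>) \<xi>) * ennreal (norm (f \<zeta>))"
        using poisson_kernel_nonneg[OF inside[OF \<zeta>]] by (simp add: ennreal_mult)
    qed
    also have "\<dots> = ennreal (norm (f \<zeta>))"
      by (subst nn_integral_multc) (auto simp: nn_integral_poisson_kernel[OF inside[OF \<zeta>]])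
    finally show "(\<integral>\<^sup>+\<xi>. ennreal (norm (poisson_kernel (of_real r * \<xi>) \<zeta> *\<^sub>R f \<zeta>)) \<partial>circle_measure) =
        ennreal (norm (f \<zeta>))" .
  qed
  finally show ?thesis .
qed

lemma integrable_poisson_integral_radial:
  fixes f :: "complex \<Rightarrow> 'a::{banach, second_countable_topology}"
  assumes f: "integrable circle_measure f" and r: "0 \<le> r" "r < 1"
  shows "integrable circle_measure (\<lambda>\<xi>. poisson_integral f (of_real r * \<xi>))"
proof (rule integrableI_bounded)
  show "(\<integral>\<^sup>+\<xi>. ennreal (norm (poisson_integral f (of_real r * \<xi>))) \<partial>circle_measure) < \<infinity>"
    using poisson_integral_radial_nn_bound[OF assms] f
    by (auto simp: integrable_iff_bounded intro: le_less_trans)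
qed (use f in \<open>simp add: measurable_poisson_integral_radial\<close>)

lemma poisson_integral_radial_contraction:
  fixes f :: "complex \<Rightarrow> 'a::{banach, second_countable_topology}"
  assumes f: "integrable circle_measure f" and r: "0 \<le> r" "r < 1"
  shows "(LINT \<xi>|circle_measure. norm (poisson_integral f (of_real r * \<xi>))) \<le>
    (LINT \<zeta>|circle_measure. norm (f \<zeta>))"
proof -
  have "ennreal (LINT \<xi>|circle_measure. norm (poisson_integral f (of_real r * \<xi>))) \<le>
      ennreal (LINT \<zeta>|circle_measure. norm (f \<zeta>))"
    using poisson_integral_radial_nn_bound[OF assms] f integrable_poisson_integral_radial[OF assms]
    by (simp add: nn_integral_eq_integral)
  then show ?thesis by (subst (asm) ennreal_le_iff) auto
qed

lemma poisson_integral_add: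
  fixes f g :: "complex \<Rightarrow> 'a::{banach, second_countable_topology}"
  assumes "integrable circle_measure f" "integrable circle_measure g" "cmod z < 1"
  shows "poisson_integral (\<lambda>\<zeta>. f \<zeta> + g \<zeta>) z = poisson_integral f z + poisson_integral g z"
  using assms by (simp add: poisson_integral_kernel scaleR_add_right integrable_poisson)

lemma poisson_integral_diff:
  fixes f g :: "complex \<Rightarrow> 'a::{banach, second_countable_topology}"
  assumes "integrable circle_measure f" "integrable circle_measure g" "cmod z < 1"
  shows "poisson_integral (\<lambda>\<zeta>. f \<zeta> - g \<zeta>) z = poisson_integral f z - poisson_integral g z"
  using assms by (simp add: poisson_integral_kernel scaleR_diff_right integrable_poisson)

lemma poisson_integral_scaleR_left:
  fixes f :: "complex \<Rightarrow> real" and c :: "'a::{banach, second_countable_topology}"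
  assumes "integrable circle_measure f" "cmod z < 1"
  shows "poisson_integral (\<lambda>\<zeta>. f \<zeta> *\<^sub>R c) z = poisson_integral f z *\<^sub>R c"
proof -
  have "(LINT \<zeta>|circle_measure. (poisson_kernel z \<zeta> *\<^sub>R f \<zeta>) *\<^sub>R c) =
      (LINT \<zeta>|circle_measure. poisson_kernel z \<zeta> *\<^sub>R f \<zeta>) *\<^sub>R c"
    using integrable_poisson[OF assms] by (intro integral_scaleR_left) auto
  then show ?thesis by (simp add: poisson_integral_kernel)
qed

lemma poisson_integral_const:
  fixes c :: "'a::{banach, second_countable_topology}"
  assumes "cmod z < 1"
  shows "poisson_integral (\<lambda>_. c) z = c"
proof -
  have "poisson_integral (\<lambda>_. 1 *\<^sub>R c) z = poisson_integral (\<lambda>_. 1 :: real) z *\<^sub>R c"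
    using assms by (intro poisson_integral_scaleR_left) auto
  also have "poisson_integral (\<lambda>_. 1 :: real) z = 1"
    using assms by (simp add: poisson_integral_kernel integral_poisson_kernel)
  finally show ?thesis by simp
qed

lemma poisson_integral_mono:
  fixes f g :: "complex \<Rightarrow> real"
  assumes "integrable circle_measure f" "integrable circle_measure g" "cmod z < 1"
    and "AE \<zeta> in circle_measure. f \<zeta> \<le> g \<zeta>"
  shows "poisson_integral f z \<le> poisson_integral g z"
  unfolding poisson_integral_kernel
proof (rule integral_mono_AE)
  show "AE \<zeta> in circle_measure. poisson_kernel z \<zeta> *\<^sub>R f \<zeta> \<le> poisson_kernel z \<zeta> *\<^sub>R g \<zeta>"
    using assms(4) by eventually_elim (intro scaleR_left_mono poisson_kernel_nonneg assms(3))
qed (intro integrable_poisson assms)+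

lemma poisson_integral_cong_AE:
  assumes "AE \<zeta> in circle_measure. f \<zeta> = g \<zeta>"
    and [measurable]: "f \<in> borel_measurable circle_measure" "g \<in> borel_measurable circle_measure"
  shows "poisson_integral f z = poisson_integral g z"
  unfolding poisson_integral_kernel
proof (rule integral_cong_AE)
  show "AE \<zeta> in circle_measure. poisson_kernel z \<zeta> *\<^sub>R f \<zeta> = poisson_kernel z \<zeta> *\<^sub>R g \<zeta>"
    using assms(1) by eventually_elim simp
qed measurable

lemma poisson_integral_norm_le:
  fixes f :: "complex \<Rightarrow> 'a::{banach, second_countable_topology}"
  assumes f: "integrable circle_measure f" and z: "cmod z < 1"
  shows "norm (poisson_integral f z) \<le> poisson_integral (\<lambda>\<zeta>. norm (f \<zeta>)) z"
proof -
  have "norm (poisson_integral f z) \<le> (LINT \<zeta>|circle_measure. norm (poisson_kernel z \<zeta> *\<^sub>R f \<zeta>))"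
    unfolding poisson_integral_kernel by (rule integral_norm_bound)
  then show ?thesis
    using poisson_kernel_nonneg[OF z] by (simp add: poisson_integral_kernel)
qed

text \<open>The usual splitting for an approximate identity: near \<open>\<xi>\<close> the function varies by at most
  \<open>e/2\<close>; away from \<open>\<xi>\<close> the kernel is at most a multiple of \<open>1 - (r n)\<^sup>2\<close>.\<close>
lemma poisson_integral_radial_tendsto_continuous:
  fixes \<phi> :: "complex \<Rightarrow> real"
  assumes r: "\<And>n. 0 \<le> r n" "\<And>n. r n < 1" "r \<longlonglongrightarrow> 1"
    and \<phi>: "continuous_on (sphere 0 1) \<phi>" and bd: "\<And>\<zeta>. cmod \<zeta> = 1 \<Longrightarrow> \<bar>\<phi> \<zeta>\<bar> \<le> B"
    and \<xi>: "cmod \<xi> = 1"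
  shows "(\<lambda>n. poisson_integral \<phi> (of_real (r n) * \<xi>)) \<longlonglongrightarrow> \<phi> \<xi>"
proof (rule LIMSEQ_I)
  fix e :: real assume "0 < e"
  have B: "0 \<le> B" using bd[OF \<xi>] by linarith
  obtain d where d: "0 < d" "\<And>\<zeta>. cmod \<zeta> = 1 \<Longrightarrow> dist \<zeta> \<xi> < d \<Longrightarrow> dist (\<phi> \<zeta>) (\<phi> \<xi>) < e / 2"
    using \<phi> \<xi> \<open>0 < e\<close> unfolding continuous_on_iff by (metis half_gt_zero mem_sphere_0)
  have m [measurable]: "\<phi> \<in> borel_measurable circle_measure"
    using \<phi> by (rule measurable_circle_continuous)
  have int: "integrable circle_measure \<phi>"
    using bd by (intro circle.integrable_const_bound[where B = B]) auto
  have lim: "(\<lambda>n. e / 2 + (1 - (r n)\<^sup>2) * (8 * B / d\<^sup>2)) \<longlonglongrightarrow> e / 2 + (1 - 1\<^sup>2) * (8 * B / d\<^sup>2)"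
    by (intro tendsto_intros r)
  have ev: "\<forall>\<^sub>F n in sequentially. e / 2 + (1 - (r n)\<^sup>2) * (8 * B / d\<^sup>2) < e \<and> 1 - d / 2 < r n"
    using order_tendstoD(2)[OF lim, of e] order_tendstoD(1)[OF r(3), of "1 - d / 2"] \<open>0 < e\<close> d(1)
    by (intro eventually_conj) auto
  have bound: "\<bar>poisson_integral \<phi> (of_real (r n) * \<xi>) - \<phi> \<xi>\<bar> \<le> e / 2 + (1 - (r n)\<^sup>2) * (8 * B / d\<^sup>2)"
    if n: "1 - d / 2 < r n" for n
  proof -
    define z where "z = of_real (r n) * \<xi>"
    have cz: "cmod z = r n" using r(1) \<xi> by (simp add: z_def norm_mult)
    then have z: "cmod z < 1" using r by simp
    have rn: "0 \<le> 1 - (r n)\<^sup>2" using r by (simp add: abs_square_le_1 less_imp_le)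
    have dxz: "dist \<xi> z = 1 - r n"
    proof -
      have "\<xi> - z = of_real (1 - r n) * \<xi>" by (simp add: z_def algebra_simps)
      then have "dist \<xi> z = \<bar>1 - r n\<bar> * cmod \<xi>" by (simp add: dist_norm norm_mult flip: of_real_diff)
      then show ?thesis using \<xi> r(2)[of n] by simp
    qed
    have "\<bar>poisson_integral \<phi> z - \<phi> \<xi>\<bar> = norm (poisson_integral (\<lambda>\<zeta>. \<phi> \<zeta> - \<phi> \<xi>) z)"
      using int z by (simp add: poisson_integral_diff poisson_integral_const)
    also have "\<dots> \<le> (LINT \<zeta>|circle_measure. poisson_kernel z \<zeta> *\<^sub>R norm (\<phi> \<zeta> - \<phi> \<xi>))"
      using poisson_integral_norm_le[OF _ z, of "\<lambda>\<zeta>. \<phi> \<zeta> - \<phi> \<xi>"] int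
      by (simp add: poisson_integral_kernel)
    also have "\<dots> \<le> (LINT \<zeta>|circle_measure. poisson_kernel z \<zeta> *\<^sub>R (e / 2) + (1 - (r n)\<^sup>2) * (8 * B / d\<^sup>2))"
    proof (rule integral_mono)
      show "integrable circle_measure (\<lambda>\<zeta>. poisson_kernel z \<zeta> *\<^sub>R norm (\<phi> \<zeta> - \<phi> \<xi>))"
        using int by (intro integrable_poisson z) auto
      show "integrable circle_measure (\<lambda>\<zeta>. poisson_kernel z \<zeta> *\<^sub>R (e / 2) + (1 - (r n)\<^sup>2) * (8 * B / d\<^sup>2))"
        using z by (intro Bochner_Integration.integrable_add integrable_poisson) auto
      fix \<zeta> assume "\<zeta> \<in> space circle_measure"
      then have \<zeta>: "cmod \<zeta> = 1" by simp
      have K: "0 \<le> poisson_kernel z \<zeta>" using z by (rule poisson_kernel_nonneg)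
      show "poisson_kernel z \<zeta> *\<^sub>R norm (\<phi> \<zeta> - \<phi> \<xi>) \<le>
          poisson_kernel z \<zeta> *\<^sub>R (e / 2) + (1 - (r n)\<^sup>2) * (8 * B / d\<^sup>2)"
      proof (cases "dist \<zeta> \<xi> < d")
        case True
        then have "norm (\<phi> \<zeta> - \<phi> \<xi>) \<le> e / 2" using d(2)[OF \<zeta>] by (simp add: dist_norm)
        then have "poisson_kernel z \<zeta> *\<^sub>R norm (\<phi> \<zeta> - \<phi> \<xi>) \<le> poisson_kernel z \<zeta> *\<^sub>R (e / 2)"
          using K by (rule scaleR_left_mono)
        moreover have "0 \<le> (1 - (r n)\<^sup>2) * (8 * B / d\<^sup>2)"
          using rn B by (intro mult_nonneg_nonneg divide_nonneg_nonneg) auto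
        ultimately show ?thesis by linarith
      next
        case False
        \<comment> \<open>the dilated point lies within \<open>d/2\<close> of \<open>\<xi>\<close>, which leaves \<open>d/2\<close> of the distance \<open>d\<close>\<close>
        have "d / 2 \<le> cmod (\<zeta> - z)"
          using False dist_triangle[of \<zeta> \<xi> z] dxz n by (simp add: dist_norm norm_minus_commute)
        then have "(d / 2)\<^sup>2 \<le> (cmod (\<zeta> - z))\<^sup>2" using d(1) by (intro power_mono) auto
        then have "poisson_kernel z \<zeta> \<le> (1 - (r n)\<^sup>2) / (d / 2)\<^sup>2"
          unfolding poisson_kernel_def cz using d(1) rn by (intro frac_le) auto
        moreover have "norm (\<phi> \<zeta> - \<phi> \<xi>) \<le> 2 * B" using bd[OF \<zeta>] bd[OF \<xi>] by simp
        ultimately have "poisson_kernel z \<zeta> * norm (\<phi> \<zeta> - \<phi> \<xi>) \<le> (1 - (r n)\<^sup>2) / (d / 2)\<^sup>2 * (2 * B)"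
          using K rn by (intro mult_mono) auto
        also have "\<dots> = (1 - (r n)\<^sup>2) * (8 * B / d\<^sup>2)" by (simp add: power2_eq_square)
        finally show ?thesis using K \<open>0 < e\<close> by (simp add: add_increasing)
      qed
    qed
    also have "\<dots> = e / 2 + (1 - (r n)\<^sup>2) * (8 * B / d\<^sup>2)"
    proof -
      have i: "integrable circle_measure (\<lambda>\<zeta>. poisson_kernel z \<zeta> *\<^sub>R (e / 2))"
        using z by (intro integrable_poisson) auto
      have "(LINT \<zeta>|circle_measure. poisson_kernel z \<zeta> *\<^sub>R (e / 2)) = e / 2"
        using poisson_integral_const[OF z, of "e / 2"] by (simp only: poisson_integral_kernel)
      then show ?thesis by (subst Bochner_Integration.integral_add[OF i]) (auto simp: circle.prob_space)
    qed
    finally show ?thesis by (simp add: z_def)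
  qed
  have "\<forall>\<^sub>F n in sequentially. norm (poisson_integral \<phi> (of_real (r n) * \<xi>) - \<phi> \<xi>) < e"
    using ev by eventually_elim (use bound in force)
  then show "\<exists>N. \<forall>n\<ge>N. norm (poisson_integral \<phi> (of_real (r n) * \<xi>) - \<phi> \<xi>) < e"
    by (simp add: eventually_sequentially)
qed

section \<open>Mean convergence of radial Poisson integrals\<close>

lemma radii_tending_to_1:
  obtains r :: "nat \<Rightarrow> real" where "\<And>n. 0 \<le> r n" "\<And>n. r n < 1" "r \<longlonglongrightarrow> 1"
proof
  show "(\<lambda>n. 1 - 1 / real (Suc n)) \<longlonglongrightarrow> 1" by real_asymp
qed auto

context
  fixes r :: "nat \<Rightarrow> real"
  assumes r_nonneg: "\<And>n. 0 \<le> r n" and r_less: "\<And>n. r n < 1" and r_lim: "r \<longlonglongrightarrow> 1"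
begin

text \<open>This class of functions is a vector space and closed under \<open>L\<^sup>1\<close> limits; these closure
  properties carry the induction from continuous functions through Borel sets to all integrable
  functions.\<close>
definition radial_L1_limit :: "(complex \<Rightarrow> 'a::{banach, second_countable_topology}) \<Rightarrow> bool" where
  "radial_L1_limit f \<longleftrightarrow> integrable circle_measure f \<and>
     (\<lambda>n. LINT \<xi>|circle_measure. norm (poisson_integral f (of_real (r n) * \<xi>) - f \<xi>)) \<longlonglongrightarrow> 0"

lemma radial_inside: "cmod \<xi> = 1 \<Longrightarrow> cmod (of_real (r n) * \<xi>) < 1"
  using r_nonneg[of n] r_less[of n] by (simp add: norm_mult)

lemma integrable_radial_error:
  "integrable circle_measure f \<Longrightarrow>
    integrable circle_measure (\<lambda>\<xi>. norm (poisson_integral f (of_real (r n) * \<xi>) - f \<xi>))"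
  using r_nonneg r_less by (intro integrable_norm Bochner_Integration.integrable_diff integrable_poisson_integral_radial) auto

lemma radial_L1_limitI_le:
  fixes f :: "complex \<Rightarrow> 'a::{banach, second_countable_topology}"
  assumes f: "integrable circle_measure f" and u: "u \<longlonglongrightarrow> 0"
    and "\<And>n. (LINT \<xi>|circle_measure. norm (poisson_integral f (of_real (r n) * \<xi>) - f \<xi>)) \<le> u n"
  shows "radial_L1_limit f"
  unfolding radial_L1_limit_def
proof (intro conjI f)
  show "(\<lambda>n. LINT \<xi>|circle_measure. norm (poisson_integral f (of_real (r n) * \<xi>) - f \<xi>)) \<longlonglongrightarrow> 0"
    by (rule tendsto_sandwich[OF _ _ tendsto_const u]) (use assms(3) in auto)
qed

lemma radial_L1_limit_add:
  assumes "radial_L1_limit f" "radial_L1_limit g"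
  shows "radial_L1_limit (\<lambda>\<zeta>. f \<zeta> + g \<zeta>)"
proof -
  have fg: "integrable circle_measure f" "integrable circle_measure g"
    using assms by (auto simp: radial_L1_limit_def)
  show ?thesis
  proof (rule radial_L1_limitI_le)
    show "(\<lambda>n. (LINT \<xi>|circle_measure. norm (poisson_integral f (of_real (r n) * \<xi>) - f \<xi>)) +
        (LINT \<xi>|circle_measure. norm (poisson_integral g (of_real (r n) * \<xi>) - g \<xi>))) \<longlonglongrightarrow> 0"
      using assms by (auto simp: radial_L1_limit_def intro: tendsto_add_zero)
    fix n
    have "(LINT \<xi>|circle_measure. norm (poisson_integral (\<lambda>\<zeta>. f \<zeta> + g \<zeta>) (of_real (r n) * \<xi>) - (f \<xi> + g \<xi>)))
        \<le> (LINT \<xi>|circle_measure. norm (poisson_integral f (of_real (r n) * \<xi>) - f \<xi>) +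
            norm (poisson_integral g (of_real (r n) * \<xi>) - g \<xi>))"
    proof (rule integral_mono)
      fix \<xi> assume "\<xi> \<in> space circle_measure"
      then have "poisson_integral (\<lambda>\<zeta>. f \<zeta> + g \<zeta>) (of_real (r n) * \<xi>) =
          poisson_integral f (of_real (r n) * \<xi>) + poisson_integral g (of_real (r n) * \<xi>)"
        using fg radial_inside by (intro poisson_integral_add) auto
      then show "norm (poisson_integral (\<lambda>\<zeta>. f \<zeta> + g \<zeta>) (of_real (r n) * \<xi>) - (f \<xi> + g \<xi>)) \<le>
          norm (poisson_integral f (of_real (r n) * \<xi>) - f \<xi>) +
            norm (poisson_integral g (of_real (r n) * \<xi>) - g \<xi>)"
        by (simp add: norm_diff_triangle_ineq)
    qed (use fg in \<open>auto intro!: integrable_radial_error Bochner_Integration.integrable_add\<close>)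
    then show "(LINT \<xi>|circle_measure. norm (poisson_integral (\<lambda>\<zeta>. f \<zeta> + g \<zeta>) (of_real (r n) * \<xi>) - (f \<xi> + g \<xi>)))
        \<le> (LINT \<xi>|circle_measure. norm (poisson_integral f (of_real (r n) * \<xi>) - f \<xi>)) +
        (LINT \<xi>|circle_measure. norm (poisson_integral g (of_real (r n) * \<xi>) - g \<xi>))"
      using fg by (simp add: integrable_radial_error)
  qed (use fg in simp)
qed

lemma radial_L1_limit_scaleR_left:
  fixes f :: "complex \<Rightarrow> real" and c :: "'a::{banach, second_countable_topology}"
  assumes "radial_L1_limit f"
  shows "radial_L1_limit (\<lambda>\<zeta>. f \<zeta> *\<^sub>R c)"
proof -
  have f: "integrable circle_measure f" using assms by (auto simp: radial_L1_limit_def)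
  show ?thesis
  proof (rule radial_L1_limitI_le)
    show "(\<lambda>n. (LINT \<xi>|circle_measure. norm (poisson_integral f (of_real (r n) * \<xi>) - f \<xi>)) * norm c) \<longlonglongrightarrow> 0"
      using assms by (auto simp: radial_L1_limit_def intro: tendsto_mult_left_zero)
    fix n
    have "(LINT \<xi>|circle_measure. norm (poisson_integral (\<lambda>\<zeta>. f \<zeta> *\<^sub>R c) (of_real (r n) * \<xi>) - f \<xi> *\<^sub>R c)) =
       (LINT \<xi>|circle_measure. norm (poisson_integral f (of_real (r n) * \<xi>) - f \<xi>) * norm c)"
      using f radial_inside
      by (intro Bochner_Integration.integral_cong)
        (auto simp: poisson_integral_scaleR_left simp flip: scaleR_diff_left)
    then show "(LINT \<xi>|circle_measure. norm (poisson_integral (\<lambda>\<zeta>. f \<zeta> *\<^sub>R c) (of_real (r n) * \<xi>) - f \<xi> *\<^sub>R c)) \<le>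
       (LINT \<xi>|circle_measure. norm (poisson_integral f (of_real (r n) * \<xi>) - f \<xi>)) * norm c"
      by simp
  qed (use f in simp)
qed

text \<open>An \<open>e/3\<close> argument: the contraction property controls the Poisson means of \<open>f - g i\<close> by the
  \<open>L\<^sup>1\<close> norm of \<open>f - g i\<close>, uniformly in the radius.\<close>
lemma radial_L1_limit_closed:
  fixes f :: "complex \<Rightarrow> 'a::{banach, second_countable_topology}"
  assumes f: "integrable circle_measure f" and g: "\<And>i. radial_L1_limit (g i)"
    and lim: "(\<lambda>i. LINT \<xi>|circle_measure. norm (g i \<xi> - f \<xi>)) \<longlonglongrightarrow> 0"
  shows "radial_L1_limit f"
  unfolding radial_L1_limit_def
proof (intro conjI f LIMSEQ_I)
  fix e :: real assume e: "0 < e"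
  have gi: "integrable circle_measure (g i)" for i using g by (auto simp: radial_L1_limit_def)
  define E where "E = (\<lambda>h n. LINT \<xi>|circle_measure. norm (poisson_integral h (of_real (r n) * \<xi>) - h \<xi> :: 'a))"
  have "\<forall>\<^sub>F i in sequentially. (LINT \<xi>|circle_measure. norm (g i \<xi> - f \<xi>)) < e / 3"
    using e by (intro order_tendstoD(2)[OF lim]) auto
  then obtain i where i: "(LINT \<xi>|circle_measure. norm (g i \<xi> - f \<xi>)) < e / 3"
    by (auto simp: eventually_sequentially)
  have "E (g i) \<longlonglongrightarrow> 0" using g[of i] by (simp add: E_def radial_L1_limit_def)
  then obtain N where N: "E (g i) n < e / 3" if "N \<le> n" for n
    using order_tendstoD(2)[of "E (g i)" 0 sequentially "e / 3"] e by (auto simp: eventually_sequentially)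
  have "E f n < e" if n: "N \<le> n" for n
  proof -
    define d where "d = (\<lambda>\<xi>. f \<xi> - g i \<xi>)"
    have d: "integrable circle_measure d" using f gi by (simp add: d_def)
    have Pd: "integrable circle_measure (\<lambda>\<xi>. norm (poisson_integral d (of_real (r n) * \<xi>)))"
      using d r_nonneg r_less by (intro integrable_norm integrable_poisson_integral_radial) auto
    have "E f n \<le> (LINT \<xi>|circle_measure. norm (poisson_integral d (of_real (r n) * \<xi>)) +
        norm (poisson_integral (g i) (of_real (r n) * \<xi>) - g i \<xi>) + norm (d \<xi>))"
      unfolding E_def
    proof (rule integral_mono)
      fix \<xi> assume "\<xi> \<in> space circle_measure"
      then have *: "poisson_integral d (of_real (r n) * \<xi>) =
          poisson_integral f (of_real (r n) * \<xi>) - poisson_integral (g i) (of_real (r n) * \<xi>)"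
        unfolding d_def using f gi radial_inside by (intro poisson_integral_diff) auto
      have "poisson_integral f (of_real (r n) * \<xi>) - f \<xi> = poisson_integral d (of_real (r n) * \<xi>) +
        (poisson_integral (g i) (of_real (r n) * \<xi>) - g i \<xi>) + (- d \<xi>)"
        unfolding * by (simp add: d_def)
      then show "norm (poisson_integral f (of_real (r n) * \<xi>) - f \<xi>) \<le>
          norm (poisson_integral d (of_real (r n) * \<xi>)) +
          norm (poisson_integral (g i) (of_real (r n) * \<xi>) - g i \<xi>) + norm (d \<xi>)"
        by (metis norm_minus_cancel norm_triangle_le norm_triangle_ineq add_right_mono)
    qed (use f gi d Pd in \<open>auto intro!: integrable_radial_error Bochner_Integration.integrable_add\<close>)
    also have "\<dots> = (LINT \<xi>|circle_measure. norm (poisson_integral d (of_real (r n) * \<xi>))) + E (g i) n +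
        (LINT \<xi>|circle_measure. norm (d \<xi>))"
      using Pd d gi integrable_radial_error[OF gi] by (simp add: E_def)
    also have "\<dots> \<le> (LINT \<xi>|circle_measure. norm (d \<xi>)) + E (g i) n + (LINT \<xi>|circle_measure. norm (d \<xi>))"
      using d r_nonneg r_less by (intro add_right_mono poisson_integral_radial_contraction) auto
    also have "\<dots> < e"
      using i N[OF n] by (simp add: d_def norm_minus_commute)
    finally show ?thesis .
  qed
  then show "\<exists>N. \<forall>n\<ge>N. norm ((LINT \<xi>|circle_measure. norm (poisson_integral f (of_real (r n) * \<xi>) - f \<xi>)) - 0) < e"
    by (auto simp: E_def)
qed

lemma radial_L1_limit_dominated:
  fixes f :: "complex \<Rightarrow> 'a::{banach, second_countable_topology}"
  assumes g: "\<And>i. radial_L1_limit (g i)" and [measurable]: "f \<in> borel_measurable circle_measure"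
    and lim: "\<And>\<xi>. cmod \<xi> = 1 \<Longrightarrow> (\<lambda>i. g i \<xi>) \<longlonglongrightarrow> f \<xi>"
    and w: "integrable circle_measure w" and bd: "\<And>i \<xi>. cmod \<xi> = 1 \<Longrightarrow> norm (g i \<xi>) \<le> w \<xi>"
  shows "radial_L1_limit f"
proof (rule radial_L1_limit_closed[OF _ g])
  have [measurable]: "g i \<in> borel_measurable circle_measure" for i
    using g[of i] unfolding radial_L1_limit_def by (blast intro: borel_measurable_integrable)
  have fw: "norm (f \<xi>) \<le> w \<xi>" if "cmod \<xi> = 1" for \<xi>
    using tendsto_norm[OF lim[OF that]] bd[OF that] by (intro LIMSEQ_le_const2) auto
  show f: "integrable circle_measure f"
    by (rule Bochner_Integration.integrable_bound[OF w]) (auto intro!: AE_I2 order_trans[OF fw])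
  have "(\<lambda>i. LINT \<xi>|circle_measure. norm (g i \<xi> - f \<xi>)) \<longlonglongrightarrow> (LINT \<xi>|circle_measure. 0)"
  proof (rule integral_dominated_convergence)
    show "integrable circle_measure (\<lambda>\<xi>. 2 * w \<xi>)" using w by simp
    show "AE \<xi> in circle_measure. (\<lambda>i. norm (g i \<xi> - f \<xi>)) \<longlonglongrightarrow> 0"
      using lim by (intro AE_I2 tendsto_norm_zero LIM_zero) auto
    show "AE \<xi> in circle_measure. norm (norm (g i \<xi> - f \<xi>)) \<le> 2 * w \<xi>" for i
    proof (rule AE_I2)
      fix \<xi> assume "\<xi> \<in> space circle_measure"
      then show "norm (norm (g i \<xi> - f \<xi>)) \<le> 2 * w \<xi>"
        using fw[of \<xi>] bd[of \<xi> i] norm_triangle_ineq4[of "g i \<xi>" "f \<xi>"] by simp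
    qed
  qed measurable
  then show "(\<lambda>i. LINT \<xi>|circle_measure. norm (g i \<xi> - f \<xi>)) \<longlonglongrightarrow> 0" by simp
qed

lemma radial_L1_limit_continuous:
  fixes \<phi> :: "complex \<Rightarrow> real"
  assumes \<phi>: "continuous_on (sphere 0 1) \<phi>" and bd: "\<And>\<zeta>. cmod \<zeta> = 1 \<Longrightarrow> \<bar>\<phi> \<zeta>\<bar> \<le> B"
  shows "radial_L1_limit \<phi>"
  unfolding radial_L1_limit_def
proof (intro conjI)
  have [measurable]: "\<phi> \<in> borel_measurable circle_measure"
    using \<phi> by (rule measurable_circle_continuous)
  note measurable_poisson_integral_radial [measurable]
  show int: "integrable circle_measure \<phi>"
    using bd by (intro circle.integrable_const_bound[where B = B]) auto
  have "(\<lambda>n. LINT \<xi>|circle_measure. norm (poisson_integral \<phi> (of_real (r n) * \<xi>) - \<phi> \<xi>)) \<longlonglongrightarrow>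
      (LINT \<xi>|circle_measure. 0)"
  proof (rule integral_dominated_convergence)
    show "AE \<xi> in circle_measure. (\<lambda>n. norm (poisson_integral \<phi> (of_real (r n) * \<xi>) - \<phi> \<xi>)) \<longlonglongrightarrow> 0"
      using poisson_integral_radial_tendsto_continuous[OF r_nonneg r_less r_lim \<phi> bd]
      by (intro AE_I2 tendsto_norm_zero LIM_zero) auto
    show "integrable circle_measure (\<lambda>_. 2 * B)" by simp
    show "AE \<xi> in circle_measure. norm (norm (poisson_integral \<phi> (of_real (r n) * \<xi>) - \<phi> \<xi>)) \<le> 2 * B" for n
    proof (rule AE_I2)
      fix \<xi> assume "\<xi> \<in> space circle_measure"
      then have \<xi>: "cmod \<xi> = 1" by simp
      define z where "z = of_real (r n) * \<xi>"
      have z: "cmod z < 1" unfolding z_def using \<xi> by (rule radial_inside)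
      have "norm (poisson_integral \<phi> z) \<le> poisson_integral (\<lambda>\<zeta>. norm (\<phi> \<zeta>)) z"
        using int z by (rule poisson_integral_norm_le)
      also have "\<dots> \<le> poisson_integral (\<lambda>_. B) z"
        using int z bd by (intro poisson_integral_mono) auto
      also have "\<dots> = B" using z by (rule poisson_integral_const)
      finally have "norm (poisson_integral \<phi> (of_real (r n) * \<xi>)) \<le> B" by (simp add: z_def)
      then show "norm (norm (poisson_integral \<phi> (of_real (r n) * \<xi>) - \<phi> \<xi>)) \<le> 2 * B"
        using bd[OF \<xi>] norm_triangle_ineq4[of "poisson_integral \<phi> (of_real (r n) * \<xi>)" "\<phi> \<xi>"] by simp
    qed
  qed measurable
  then show "(\<lambda>n. LINT \<xi>|circle_measure. norm (poisson_integral \<phi> (of_real (r n) * \<xi>) - \<phi> \<xi>)) \<longlonglongrightarrow> 0"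
    by simp
qed

lemma measurable_circle_indicator [measurable]:
  "A \<in> sets borel \<Longrightarrow> indicat_real A \<in> borel_measurable circle_measure"
  using measurable_compose[OF measurable_circle_ident borel_measurable_indicator, of A] by simp

text \<open>The indicator of a closed set is the pointwise limit of the continuous functions
  \<open>max 0 (1 - k * infdist z C)\<close>. For the empty set these would all be 1, since then
  \<^const>\<open>infdist\<close> is 0 by convention.\<close>
lemma radial_L1_limit_indicator_closed:
  assumes C: "closed C"
  shows "radial_L1_limit (indicat_real C)"
proof (cases "C = {}")
  case True
  then have "indicat_real C = (\<lambda>_. 0)" by (auto simp: fun_eq_iff)
  then show ?thesis
    using radial_L1_limit_continuous[of "\<lambda>_. 0" 0] by simp
next
  case False
  define \<phi> where "\<phi> = (\<lambda>k z. max 0 (1 - real k * infdist z C))"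
  show ?thesis
  proof (rule radial_L1_limit_dominated[where g = \<phi> and w = "\<lambda>_. 1"])
    show "radial_L1_limit (\<phi> k)" for k
      unfolding \<phi>_def
      by (rule radial_L1_limit_continuous[where B = 1])
         (auto intro!: continuous_intros simp: infdist_nonneg)
    show "(\<lambda>k. \<phi> k \<xi>) \<longlonglongrightarrow> indicat_real C \<xi>" if "cmod \<xi> = 1" for \<xi>
    proof (cases "\<xi> \<in> C")
      case True
      then show ?thesis by (simp add: \<phi>_def)
    next
      case outside: False
      then have pos: "0 < infdist \<xi> C"
        using C False infdist_pos_not_in_closed by blast
      then obtain N where N: "1 < real N * infdist \<xi> C"
        using ex_less_of_nat_mult by blast
      have "\<forall>\<^sub>F k in sequentially. \<phi> k \<xi> = 0"
        using eventually_ge_at_top[of N]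
      proof eventually_elim
        case (elim k)
        have "real N * infdist \<xi> C \<le> real k * infdist \<xi> C"
          using elim pos by (intro mult_right_mono) auto
        then show ?case using N by (simp add: \<phi>_def)
      qed
      then show ?thesis using outside by (simp add: tendsto_eventually)
    qed
  qed (use C in \<open>auto simp: \<phi>_def infdist_nonneg\<close>)
qed

text \<open>Closed sets are stable under intersection and generate the Borel sets, so Dynkin's theorem
  reduces the claim to them.\<close>
lemma radial_L1_limit_indicator:
  assumes "A \<in> sets borel"
  shows "radial_L1_limit (indicat_real A)"
proof -
  have one: "radial_L1_limit (\<lambda>_. 1 :: real)"
    by (rule radial_L1_limit_continuous[where B = 1]) auto
  have zero: "radial_L1_limit (\<lambda>_. 0 :: real)"
    by (rule radial_L1_limit_continuous[where B = 0]) auto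
  have stable: "Int_stable (Collect closed :: complex set set)"
    by (auto simp: Int_stable_def)
  have sub: "Collect closed \<subseteq> Pow (UNIV :: complex set)"
    by simp
  have "A \<in> sigma_sets UNIV (Collect closed)"
    using assms by (simp add: borel_eq_closed)
  from stable sub this show ?thesis
  proof (induction rule: sigma_sets_induct_disjoint)
    case (compl A)
    have "radial_L1_limit (\<lambda>z. 1 + indicat_real A z *\<^sub>R (- 1 :: real))"
      by (rule radial_L1_limit_add[OF one radial_L1_limit_scaleR_left[OF compl(2)]])
    also have "(\<lambda>z. 1 + indicat_real A z *\<^sub>R (- 1 :: real)) = indicat_real (UNIV - A)"
      by (auto simp: indicator_def fun_eq_iff)
    finally show ?case .
  next
    case (union A)
    have A: "A i \<in> sets borel" for i
      using union(2) by (auto simp: borel_eq_closed)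
    have sums: "(\<lambda>i. indicat_real (A i) z) sums indicat_real (\<Union>i. A i) z" for z
      using union(1) by (auto intro!: indicator_sums simp: disjoint_family_on_def)
    show ?case
    proof (rule radial_L1_limit_dominated[where w = "\<lambda>_. 1"])
      show "radial_L1_limit (\<lambda>z. \<Sum>i<k. indicat_real (A i) z)" for k
        by (induction k) (auto simp: zero intro: radial_L1_limit_add union)
      show "(\<lambda>k. \<Sum>i<k. indicat_real (A i) \<xi>) \<longlonglongrightarrow> indicat_real (\<Union>i. A i) \<xi>" for \<xi>
        using sums[of \<xi>] by (simp add: sums_def)
      show "norm (\<Sum>i<k. indicat_real (A i) \<xi>) \<le> 1" for k \<xi>
      proof -
        have "(\<Sum>i<k. indicat_real (A i) \<xi>) \<le> (\<Sum>i. indicat_real (A i) \<xi>)"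
          using sums[of \<xi>] by (intro sum_le_suminf) (auto simp: sums_iff)
        also have "\<dots> \<le> 1" using sums[of \<xi>] by (simp add: sums_iff indicator_le_1)
        finally show ?thesis by (simp add: sum_nonneg)
      qed
    qed (use A in auto)
  qed (auto intro: radial_L1_limit_indicator_closed zero)
qed

theorem radial_L1_limit_integrable:
  fixes f :: "complex \<Rightarrow> 'a::{banach, second_countable_topology}"
  assumes "integrable circle_measure f"
  shows "radial_L1_limit f"
  using assms
proof (induction rule: integrable_induct)
  case (base A c)
  then have "A \<in> sets borel"
    by (auto simp: sets_circle_measure sets_restrict_space)
  then show ?case by (intro radial_L1_limit_scaleR_left radial_L1_limit_indicator)
next
  case (add f g)
  then show ?case by (intro radial_L1_limit_add)
next
  case (lim f s)
  show ?case
  proof (rule radial_L1_limit_dominated[where w = "\<lambda>x. 2 * norm (f x)"])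
    show "radial_L1_limit (s i)" for i by fact
  qed (use lim in auto)
qed

lemma poisson_integral_radial_tendsto_L1:
  fixes f :: "complex \<Rightarrow> 'a::{banach, second_countable_topology}"
  assumes "integrable circle_measure f"
  shows "(\<lambda>n. LINT \<xi>|circle_measure. norm (poisson_integral f (of_real (r n) * \<xi>) - f \<xi>)) \<longlonglongrightarrow> 0"
  using radial_L1_limit_integrable[OF assms] by (simp add: radial_L1_limit_def)

end

lemma poisson_integral_radial_AE_subseq:
  fixes f :: "complex \<Rightarrow> 'a::{banach, second_countable_topology}" and r :: "nat \<Rightarrow> real"
  assumes "\<And>n. 0 \<le> r n" "\<And>n. r n < 1" "r \<longlonglongrightarrow> 1" and f: "integrable circle_measure f"
  obtains s where "strict_mono s"
    "AE \<xi> in circle_measure. (\<lambda>n. poisson_integral f (of_real (r (s n)) * \<xi>)) \<longlonglongrightarrow> f \<xi>"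
proof -
  have "\<exists>s::nat\<Rightarrow>nat. strict_mono s \<and> (AE \<xi> in circle_measure.
      (\<lambda>n. poisson_integral f (of_real (r (s n)) * \<xi>) - f \<xi>) \<longlonglongrightarrow> 0)"
  proof (rule tendsto_L1_AE_subseq)
    show "integrable circle_measure (\<lambda>\<xi>. poisson_integral f (of_real (r n) * \<xi>) - f \<xi>)" for n
      using assms by (intro Bochner_Integration.integrable_diff integrable_poisson_integral_radial)
    show "(\<lambda>n. LINT \<xi>|circle_measure. norm (poisson_integral f (of_real (r n) * \<xi>) - f \<xi>)) \<longlonglongrightarrow> 0"
      using assms by (rule poisson_integral_radial_tendsto_L1)
  qed
  then show ?thesis using that by (auto simp: LIM_zero_iff)
qed

section \<open>Boundary functions of bounded analytic functions\<close>

text \<open>The series is inserted for one factor of \<open>h * cnj h\<close> and then for the other, each time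
  by integration term by term and orthogonality.\<close>
lemma circle_parseval:
  assumes b: "summable (\<lambda>n. cmod (b n))"
    and h: "\<And>\<zeta>. cmod \<zeta> = 1 \<Longrightarrow> (\<lambda>n. b n * \<zeta> ^ n) sums h \<zeta>"
    and [measurable]: "h \<in> borel_measurable circle_measure"
  shows "(\<lambda>n. (cmod (b n))\<^sup>2) sums (LINT \<zeta>|circle_measure. (cmod (h \<zeta>))\<^sup>2)"
proof -
  have hb: "cmod (h \<zeta>) \<le> (\<Sum>n. cmod (b n))" if "cmod \<zeta> = 1" for \<zeta>
  proof -
    have "cmod (\<Sum>n. b n * \<zeta> ^ n) \<le> (\<Sum>n. cmod (b n * \<zeta> ^ n))"
      using b that by (intro summable_norm) (simp add: norm_mult norm_power)
    then show ?thesis using h[OF that] that by (simp add: sums_iff norm_mult norm_power)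
  qed
  have inth: "integrable circle_measure (\<lambda>\<zeta>. cnj (h \<zeta>))"
    using hb by (intro circle.integrable_const_bound[where B = "\<Sum>n. cmod (b n)"]) auto
  have pow: "integrable circle_measure (\<lambda>\<zeta>. cnj \<zeta> ^ n)" for n
    by (rule circle.integrable_const_bound[where B = 1]) (auto simp: norm_power)
  have coeff: "(LINT \<zeta>|circle_measure. \<zeta> ^ n * cnj (h \<zeta>)) = cnj (b n)" for n
  proof -
    have "(\<lambda>m. b m * (LINT \<zeta>|circle_measure. \<zeta> ^ m * cnj \<zeta> ^ n)) sums
        (LINT \<zeta>|circle_measure. h \<zeta> * cnj \<zeta> ^ n)"
      using b _ _ pow h by (rule circle_integral_series) (auto simp: norm_power)
    moreover have "(\<lambda>m. b m * (LINT \<zeta>|circle_measure. \<zeta> ^ m * cnj \<zeta> ^ n)) =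
        (\<lambda>m. if m = n then b m else 0)"
      by (auto simp: circle_orthogonality)
    ultimately have "(LINT \<zeta>|circle_measure. h \<zeta> * cnj \<zeta> ^ n) = b n"
      using sums_single[of n b] by (simp add: sums_unique2)
    then have "cnj (LINT \<zeta>|circle_measure. h \<zeta> * cnj \<zeta> ^ n) = cnj (b n)" by simp
    then show ?thesis
      unfolding Bochner_Integration.integral_cnj[symmetric] by (simp add: mult.commute)
  qed
  have "(\<lambda>n. b n * (LINT \<zeta>|circle_measure. \<zeta> ^ n * cnj (h \<zeta>))) sums
      (LINT \<zeta>|circle_measure. h \<zeta> * cnj (h \<zeta>))"
    using b _ _ inth h by (rule circle_integral_series) (auto simp: norm_power)
  then have "(\<lambda>n. complex_of_real ((cmod (b n))\<^sup>2)) sums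
      complex_of_real (LINT \<zeta>|circle_measure. (cmod (h \<zeta>))\<^sup>2)"
    unfolding coeff by (simp flip: complex_norm_square of_real_power)
  then show ?thesis by (simp only: sums_of_real_iff)
qed

text \<open>A form of the Cauchy-Schwarz inequality, from \<open>|h| \<le> e/2 + |h|\<^sup>2 / (2e)\<close>; it turns
  the \<open>L\<^sup>2\<close> Cauchy property of dilations into the \<open>L\<^sup>1\<close> Cauchy property.\<close>
lemma integral_norm_less:
  fixes h :: "complex \<Rightarrow> complex"
  assumes h: "integrable circle_measure h" and h2: "integrable circle_measure (\<lambda>\<zeta>. (cmod (h \<zeta>))\<^sup>2)"
    and e: "0 < e" and less: "(LINT \<zeta>|circle_measure. (cmod (h \<zeta>))\<^sup>2) < e\<^sup>2"
  shows "(LINT \<zeta>|circle_measure. cmod (h \<zeta>)) < e"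
proof -
  have "(LINT \<zeta>|circle_measure. cmod (h \<zeta>)) \<le> (LINT \<zeta>|circle_measure. e / 2 + (cmod (h \<zeta>))\<^sup>2 / (2 * e))"
  proof (rule integral_mono)
    fix \<zeta>
    have "0 \<le> (cmod (h \<zeta>) - e)\<^sup>2 / (2 * e)" using e by simp
    also have "\<dots> = e / 2 + (cmod (h \<zeta>))\<^sup>2 / (2 * e) - cmod (h \<zeta>)"
      using e by (simp add: field_simps power2_eq_square)
    finally show "cmod (h \<zeta>) \<le> e / 2 + (cmod (h \<zeta>))\<^sup>2 / (2 * e)" by simp
  qed (use h h2 in auto)
  also have "\<dots> = e / 2 + (LINT \<zeta>|circle_measure. (cmod (h \<zeta>))\<^sup>2) / (2 * e)"
    using h2 by (simp add: circle.prob_space)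
  also have "\<dots> < e / 2 + e\<^sup>2 / (2 * e)"
    using less e by (intro add_strict_left_mono divide_strict_right_mono) auto
  also have "\<dots> = e" using e by (simp add: power2_eq_square)
  finally show ?thesis .
qed

context
  fixes F :: "complex \<Rightarrow> complex" and M :: real
  assumes holF: "F holomorphic_on ball 0 1"
    and boundF: "\<And>z. cmod z < 1 \<Longrightarrow> cmod (F z) \<le> M"
begin

definition taylor_coeff :: "nat \<Rightarrow> complex" where
  "taylor_coeff n = (deriv ^^ n) F 0 / fact n"

lemma taylor_sums: "cmod z < 1 \<Longrightarrow> (\<lambda>n. taylor_coeff n * z ^ n) sums F z"
  using holomorphic_power_series[OF holF, of z] by (simp add: taylor_coeff_def)

lemma summable_taylor:
  assumes "0 \<le> r" "r < 1"
  shows "summable (\<lambda>n. cmod (taylor_coeff n * of_real r ^ n))"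
proof -
  obtain s where s: "r < s" "s < 1" using dense assms(2) by blast
  then have "summable (\<lambda>n. taylor_coeff n * complex_of_real s ^ n)"
    using taylor_sums[of "of_real s"] assms by (simp add: sums_iff)
  then show ?thesis
    by (rule powser_insidea) (use s assms in auto)
qed

lemma dilation_sums:
  assumes "0 \<le> r" "r < 1" "cmod \<zeta> = 1"
  shows "(\<lambda>n. (taylor_coeff n * of_real r ^ n) * \<zeta> ^ n) sums F (of_real r * \<zeta>)"
  using taylor_sums[of "of_real r * \<zeta>"] assms by (simp add: norm_mult power_mult_distrib mult.assoc)

lemma measurable_dilation:
  assumes "0 \<le> r" "r < 1"
  shows "(\<lambda>\<zeta>. F (of_real r * \<zeta>)) \<in> borel_measurable circle_measure"
proof (rule measurable_circle_continuous)
  have "continuous_on (ball 0 1) F" using holF by (rule holomorphic_on_imp_continuous_on)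
  then show "continuous_on (sphere 0 1) (\<lambda>\<zeta>. F (of_real r * \<zeta>))"
    by (rule continuous_on_compose2) (use assms in \<open>auto intro!: continuous_intros simp: norm_mult\<close>)
qed

text \<open>A dilation is an absolutely convergent series of the powers \<open>\<zeta> ^ n\<close>, each of which is
  reproduced by the Poisson integral.\<close>
lemma poisson_integral_dilation:
  assumes r: "0 \<le> r" "r < 1" and z: "cmod z < 1"
  shows "poisson_integral (\<lambda>\<zeta>. F (of_real r * \<zeta>)) z = F (of_real r * z)"
proof -
  have K: "integrable circle_measure (\<lambda>\<zeta>. complex_of_real (poisson_kernel z \<zeta>))"
    using integrable_poisson[of "\<lambda>_. 1 :: complex", OF _ z] by (simp add: scaleR_conv_of_real)
  have "(\<lambda>n. (taylor_coeff n * of_real r ^ n) * (LINT \<zeta>|circle_measure. \<zeta> ^ n * of_real (poisson_kernel z \<zeta>))) sums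
      (LINT \<zeta>|circle_measure. F (of_real r * \<zeta>) * of_real (poisson_kernel z \<zeta>))"
    using summable_taylor[OF r] _ _ K dilation_sums[OF r]
    by (rule circle_integral_series) (auto simp: norm_power)
  also have "(\<lambda>n. (taylor_coeff n * of_real r ^ n) * (LINT \<zeta>|circle_measure. \<zeta> ^ n * of_real (poisson_kernel z \<zeta>))) =
      (\<lambda>n. taylor_coeff n * (of_real r * z) ^ n)"
    using poisson_integral_power[OF z]
    by (simp add: poisson_integral_kernel scaleR_conv_of_real mult.commute power_mult_distrib fun_eq_iff)
  finally have "(\<lambda>n. taylor_coeff n * (of_real r * z) ^ n) sums poisson_integral (\<lambda>\<zeta>. F (of_real r * \<zeta>)) z"
    by (simp add: poisson_integral_kernel scaleR_conv_of_real mult.commute)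
  moreover have "cmod (of_real r * z) < 1"
    using r z mult_left_le_one_le[of "cmod z" r] by (simp add: norm_mult)
  ultimately show ?thesis using taylor_sums sums_unique2 by blast
qed

text \<open>By Parseval's identity the dilation by \<open>r\<close> has square norm
  \<open>\<Sum>n. |taylor_coeff n|\<^sup>2 * r ^ (2n)\<close>, which is at most \<open>M\<^sup>2\<close>; each partial sum passes
  to the limit \<open>r = 1\<close>.\<close>
lemma summable_taylor_square: "summable (\<lambda>n. (cmod (taylor_coeff n))\<^sup>2)"
proof (rule summableI_nonneg_bounded)
  fix N
  obtain r :: "nat \<Rightarrow> real" where r: "\<And>n. 0 \<le> r n" "\<And>n. r n < 1" and rlim: "r \<longlonglongrightarrow> 1"
    using radii_tending_to_1 by metis
  have "(\<Sum>n<N. (cmod (taylor_coeff n * of_real (r k) ^ n))\<^sup>2) \<le> M\<^sup>2" for k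
  proof -
    have s: "(\<lambda>n. (cmod (taylor_coeff n * of_real (r k) ^ n))\<^sup>2) sums (LINT \<zeta>|circle_measure. (cmod (F (of_real (r k) * \<zeta>)))\<^sup>2)"
      using summable_taylor[OF r] dilation_sums[OF r] measurable_dilation[OF r] by (rule circle_parseval)
    have Fb: "(cmod (F (of_real (r k) * \<zeta>)))\<^sup>2 \<le> M\<^sup>2" if "cmod \<zeta> = 1" for \<zeta>
      using that r[of k] by (intro power_mono boundF) (auto simp: norm_mult)
    have "(\<Sum>n<N. (cmod (taylor_coeff n * of_real (r k) ^ n))\<^sup>2) \<le> (\<Sum>n. (cmod (taylor_coeff n * of_real (r k) ^ n))\<^sup>2)"
      using s by (intro sum_le_suminf) (auto simp: sums_iff)
    also have "\<dots> = (LINT \<zeta>|circle_measure. (cmod (F (of_real (r k) * \<zeta>)))\<^sup>2)"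
      using s by (simp add: sums_iff)
    also have "\<dots> \<le> (LINT \<zeta>|circle_measure. M\<^sup>2)"
      using measurable_dilation[OF r] Fb
      by (intro integral_mono circle.integrable_const_bound[where B = "M\<^sup>2"]) auto
    finally show ?thesis by (simp add: circle.prob_space)
  qed
  moreover have "(\<lambda>k. \<Sum>n<N. (cmod (taylor_coeff n * of_real (r k) ^ n))\<^sup>2) \<longlonglongrightarrow>
      (\<Sum>n<N. (cmod (taylor_coeff n * of_real 1 ^ n))\<^sup>2)"
    by (intro tendsto_intros rlim)
  ultimately show "(\<Sum>n<N. (cmod (taylor_coeff n))\<^sup>2) \<le> M\<^sup>2"
    by (intro LIMSEQ_le_const2) auto
qed auto

text \<open>The distance of two dilations is compared with the distances of both to the square summable
  sequence of Taylor coefficients, that is, to the boundary function that is still to be found.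
  Those distances tend to 0 by dominated convergence for series (Tannery's theorem).\<close>
lemma dilation_L2_Cauchy:
  fixes r :: "nat \<Rightarrow> real"
  assumes r: "\<And>n. 0 \<le> r n" "\<And>n. r n < 1" "r \<longlonglongrightarrow> 1" and e: "0 < e"
  shows "\<exists>N. \<forall>i\<ge>N. \<forall>j\<ge>N.
    (LINT \<zeta>|circle_measure. (cmod (F (of_real (r i) * \<zeta>) - F (of_real (r j) * \<zeta>)))\<^sup>2) < e"
proof -
  define T where "T = (\<lambda>i n. (cmod (taylor_coeff n))\<^sup>2 * (1 - r i ^ n)\<^sup>2)"
  have T_le: "norm (T i n) \<le> (cmod (taylor_coeff n))\<^sup>2" for i n
  proof -
    have "(1 - r i ^ n)\<^sup>2 \<le> 1"
      using r(1,2)[of i] power_le_one[of "r i" n] by (intro power_le_one) auto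
    then show ?thesis by (simp add: T_def mult_left_le)
  qed
  have T_summable: "summable (T i)" for i
    using summable_taylor_square by (rule summable_comparison_test') (rule T_le)
  have "(\<lambda>i. \<Sum>n. T i n) \<longlonglongrightarrow> (\<Sum>n. (cmod (taylor_coeff n))\<^sup>2 * (1 - 1 ^ n)\<^sup>2)"
  proof (rule tannerys_theorem[THEN conjunct2, THEN conjunct2])
    show "(\<lambda>i. T i n) \<longlonglongrightarrow> (cmod (taylor_coeff n))\<^sup>2 * (1 - 1 ^ n)\<^sup>2" for n
      unfolding T_def by (intro tendsto_intros r)
    show "\<forall>\<^sub>F (n, i) in at_top \<times>\<^sub>F sequentially. norm (T i n) \<le> (cmod (taylor_coeff n))\<^sup>2"
      using T_le by (intro always_eventually) auto
  qed (use summable_taylor_square in auto)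
  then have "(\<lambda>i. \<Sum>n. T i n) \<longlonglongrightarrow> 0" by simp
  then obtain N where N: "(\<Sum>n. T i n) < e / 4" if "N \<le> i" for i
    using order_tendstoD(2)[of _ 0 sequentially "e / 4"] e by (auto simp: eventually_sequentially)
  have "(LINT \<zeta>|circle_measure. (cmod (F (of_real (r i) * \<zeta>) - F (of_real (r j) * \<zeta>)))\<^sup>2) < e"
    if ij: "N \<le> i" "N \<le> j" for i j
  proof -
    define b where "b = (\<lambda>n. taylor_coeff n * of_real (r i) ^ n - taylor_coeff n * of_real (r j) ^ n)"
    have "summable (\<lambda>n. cmod (b n))"
    proof (rule summable_comparison_test')
      show "summable (\<lambda>n. cmod (taylor_coeff n * of_real (r i) ^ n) + cmod (taylor_coeff n * of_real (r j) ^ n))"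
        using r by (intro summable_add summable_taylor)
    qed (simp add: b_def norm_triangle_ineq4)
    moreover have "(\<lambda>n. b n * \<zeta> ^ n) sums (F (of_real (r i) * \<zeta>) - F (of_real (r j) * \<zeta>))" if "cmod \<zeta> = 1" for \<zeta>
      unfolding b_def left_diff_distrib using r that by (intro sums_diff dilation_sums)
    moreover have "(\<lambda>\<zeta>. F (of_real (r i) * \<zeta>) - F (of_real (r j) * \<zeta>)) \<in> borel_measurable circle_measure"
      using r by (intro borel_measurable_diff measurable_dilation)
    ultimately have s: "(\<lambda>n. (cmod (b n))\<^sup>2) sums
        (LINT \<zeta>|circle_measure. (cmod (F (of_real (r i) * \<zeta>) - F (of_real (r j) * \<zeta>)))\<^sup>2)"
      by (rule circle_parseval)
    have b_le: "(cmod (b n))\<^sup>2 \<le> 2 * T i n + 2 * T j n" for n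
    proof -
      have "b n = taylor_coeff n * of_real (r i ^ n - r j ^ n)" by (simp add: b_def algebra_simps)
      then have "(cmod (b n))\<^sup>2 = (cmod (taylor_coeff n))\<^sup>2 * (r i ^ n - r j ^ n)\<^sup>2"
        by (simp only: norm_mult norm_of_real power_mult_distrib power2_abs)
      also have "\<dots> \<le> (cmod (taylor_coeff n))\<^sup>2 * (2 * (1 - r i ^ n)\<^sup>2 + 2 * (1 - r j ^ n)\<^sup>2)"
        using zero_le_power2[of "(1 - r i ^ n) + (1 - r j ^ n)"]
        by (intro mult_left_mono) (simp_all add: power2_eq_square algebra_simps)
      finally show ?thesis by (simp add: T_def algebra_simps)
    qed
    have "(LINT \<zeta>|circle_measure. (cmod (F (of_real (r i) * \<zeta>) - F (of_real (r j) * \<zeta>)))\<^sup>2) = (\<Sum>n. (cmod (b n))\<^sup>2)"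
      using s by (simp add: sums_iff)
    also have "\<dots> \<le> (\<Sum>n. 2 * T i n + 2 * T j n)"
      using s T_summable by (intro suminf_le b_le) (auto simp: sums_iff intro!: summable_add summable_mult)
    also have "\<dots> = 2 * (\<Sum>n. T i n) + 2 * (\<Sum>n. T j n)"
      using T_summable by (simp add: suminf_add[symmetric] suminf_mult summable_mult)
    also have "\<dots> < e" using N[OF ij(1)] N[OF ij(2)] by simp
    finally show ?thesis .
  qed
  then show ?thesis by blast
qed

text \<open>Boundary values of a bounded analytic function. They are obtained here as the almost
  everywhere limit of some sequence of dilations, which suffices to recover the function and
  avoids maximal functions: an \<open>L\<^sup>1\<close> Cauchy sequence has such a subsequence.\<close>
theorem bounded_holomorphic_boundary_function:
  obtains f where "f \<in> borel_measurable circle_measure"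
    "AE \<zeta> in circle_measure. cmod (f \<zeta>) \<le> M"
    "\<And>z. cmod z < 1 \<Longrightarrow> poisson_integral f z = F z"
proof -
  obtain r :: "nat \<Rightarrow> real" where r: "\<And>n. 0 \<le> r n" "\<And>n. r n < 1" and rlim: "r \<longlonglongrightarrow> 1"
    using radii_tending_to_1 by metis
  define S where "S = (\<lambda>n \<zeta>. F (of_real (r n) * \<zeta>))"
  have S_meas [measurable]: "S n \<in> borel_measurable circle_measure" for n
    unfolding S_def using r by (rule measurable_dilation)
  have S_bd: "cmod (S n \<zeta>) \<le> M" if "cmod \<zeta> = 1" for n \<zeta>
    unfolding S_def using that r[of n] by (intro boundF) (simp add: norm_mult)
  have S_int: "integrable circle_measure (S n)" for n
    using S_bd by (intro circle.integrable_const_bound[where B = M]) auto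
  have diff_int: "integrable circle_measure (\<lambda>\<zeta>. (cmod (S i \<zeta> - S j \<zeta>))\<^sup>2)" for i j
  proof (rule circle.integrable_const_bound[where B = "(2 * M)\<^sup>2"])
    show "AE \<zeta> in circle_measure. norm ((cmod (S i \<zeta> - S j \<zeta>))\<^sup>2) \<le> (2 * M)\<^sup>2"
      using AE_circle_sphere
    proof eventually_elim
      case (elim \<zeta>)
      have "cmod (S i \<zeta> - S j \<zeta>) \<le> 2 * M"
        using S_bd[OF elim, of i] S_bd[OF elim, of j] norm_triangle_ineq4[of "S i \<zeta>" "S j \<zeta>"] by simp
      then have "(cmod (S i \<zeta> - S j \<zeta>))\<^sup>2 \<le> (2 * M)\<^sup>2" by (rule power_mono) simp
      then show ?case by simp
    qed
  qed measurable
  have L1_Cauchy: "\<exists>N. \<forall>i\<ge>N. \<forall>j\<ge>N. (LINT \<zeta>|circle_measure. cmod (S i \<zeta> - S j \<zeta>)) < e"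
    if e: "0 < e" for e
  proof -
    obtain N where "\<forall>i\<ge>N. \<forall>j\<ge>N. (LINT \<zeta>|circle_measure. (cmod (S i \<zeta> - S j \<zeta>))\<^sup>2) < e\<^sup>2"
      using dilation_L2_Cauchy[OF r rlim, of "e\<^sup>2"] e by (auto simp: S_def)
    then show ?thesis
      using integral_norm_less[OF Bochner_Integration.integrable_diff[OF S_int S_int] diff_int e]
      by blast
  qed
  obtain s where s: "strict_mono s" "AE \<zeta> in circle_measure. Cauchy (\<lambda>i. S (s i) \<zeta>)"
    using cauchy_L1_AE_cauchy_subseq[of circle_measure S, OF S_int L1_Cauchy] by blast
  define f where "f = (\<lambda>\<zeta>. lim (\<lambda>i. S (s i) \<zeta>))"
  have f_meas [measurable]: "f \<in> borel_measurable circle_measure"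
    unfolding f_def by (rule borel_measurable_lim_metric) measurable
  have f_lim: "AE \<zeta> in circle_measure. (\<lambda>i. S (s i) \<zeta>) \<longlonglongrightarrow> f \<zeta>"
    using s(2) unfolding f_def by eventually_elim (simp add: Cauchy_convergent_iff convergent_LIMSEQ_iff)
  have f_bd: "AE \<zeta> in circle_measure. cmod (f \<zeta>) \<le> M"
    using f_lim AE_circle_sphere
  proof eventually_elim
    case (elim \<zeta>)
    then show ?case using S_bd by (intro LIMSEQ_le_const2[OF tendsto_norm[OF elim(1)]]) auto
  qed
  have "poisson_integral f z = F z" if z: "cmod z < 1" for z
  proof -
    have "(\<lambda>i. poisson_integral (S (s i)) z) \<longlonglongrightarrow> poisson_integral f z"
      unfolding poisson_integral_kernel
    proof (rule integral_dominated_convergence)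
      show "integrable circle_measure (\<lambda>\<zeta>. poisson_kernel z \<zeta> *\<^sub>R M)"
        using z by (intro integrable_poisson) auto
      show "AE \<zeta> in circle_measure. (\<lambda>i. poisson_kernel z \<zeta> *\<^sub>R S (s i) \<zeta>) \<longlonglongrightarrow> poisson_kernel z \<zeta> *\<^sub>R f \<zeta>"
        using f_lim by eventually_elim (intro tendsto_intros)
      show "AE \<zeta> in circle_measure. norm (poisson_kernel z \<zeta> *\<^sub>R S (s i) \<zeta>) \<le> poisson_kernel z \<zeta> *\<^sub>R M" for i
        using AE_circle_sphere
        by eventually_elim (use S_bd poisson_kernel_nonneg[OF z] in \<open>simp add: mult_left_mono\<close>)
    qed measurable
    moreover have "poisson_integral (S (s i)) z = F (of_real (r (s i)) * z)" for i
      unfolding S_def using r z by (rule poisson_integral_dilation)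
    moreover have "(\<lambda>i. F (of_real (r (s i)) * z)) \<longlonglongrightarrow> F z"
    proof (rule isCont_tendsto_compose[where g = F and l = z])
      show "isCont F z"
        using holF z by (intro holomorphic_on_imp_differentiable_at[THEN field_differentiable_imp_continuous_at]) auto
      have "(\<lambda>i. r (s i)) \<longlonglongrightarrow> 1"
        using LIMSEQ_subseq_LIMSEQ[OF rlim s(1)] by (simp add: o_def)
      then have "(\<lambda>i. of_real (r (s i)) * z) \<longlonglongrightarrow> of_real 1 * z" by (intro tendsto_intros)
      then show "(\<lambda>i. of_real (r (s i)) * z) \<longlonglongrightarrow> z" by simp
    qed
    ultimately show ?thesis using LIMSEQ_unique by auto
  qed
  with f_meas f_bd show ?thesis by (rule that)
qed

end

section \<open>The essential supremum and the logarithm\<close>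

lemma Linf_norm_finite:
  fixes f :: "complex \<Rightarrow> 'a::real_normed_vector"
  assumes "in_Linf f"
  obtains M where "Linf_norm f = ereal M" "0 \<le> M" "AE \<zeta> in circle_measure. norm (f \<zeta>) \<le> M"
proof -
  have AE: "AE \<zeta> in circle_measure. ereal (norm (f \<zeta>)) \<le> Linf_norm f"
    unfolding Linf_norm_def by (rule esssup_AE)
  then have "AE \<zeta> in circle_measure. 0 \<le> Linf_norm f"
    by eventually_elim (meson order_trans ereal_less_eq(5) norm_ge_zero)
  then have "0 \<le> Linf_norm f" by simp
  moreover have "Linf_norm f < \<infinity>" using assms by (simp add: in_Linf_def)
  ultimately obtain M where M: "Linf_norm f = ereal M" "0 \<le> M"
    by (cases "Linf_norm f") auto
  with AE that show ?thesis by simp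
qed

lemma in_LinfI:
  assumes [measurable]: "f \<in> borel_measurable circle_measure"
    and "AE \<zeta> in circle_measure. norm (f \<zeta>) \<le> M"
  shows "in_Linf f"
proof -
  have "Linf_norm f \<le> ereal M"
    unfolding Linf_norm_def by (rule esssup_I) (use assms in auto)
  then show ?thesis by (auto simp: in_Linf_def)
qed

lemma Linf_norm_cong:
  assumes [measurable]: "f \<in> borel_measurable circle_measure" "g \<in> borel_measurable circle_measure"
    and "AE \<zeta> in circle_measure. norm (f \<zeta>) = norm (g \<zeta>)"
  shows "Linf_norm f = Linf_norm g"
  unfolding Linf_norm_def by (rule esssup_AE_cong) (use assms in auto)

text \<open>The positive part of \<open>log \<eta>\<close> is bounded, so an extended integral above \<open>-\<infinity>\<close> forces
  the negative part to have a finite integral. In particular \<open>log \<eta>\<close> is finite almost everywhere.\<close>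
lemma log_integrable_circle:
  assumes "in_Linf \<eta>" and "extended_integral circle_measure (\<lambda>\<zeta>. elog (\<eta> \<zeta>)) > -\<infinity>"
  shows "AE \<zeta> in circle_measure. 0 < \<eta> \<zeta>" "integrable circle_measure (\<lambda>\<zeta>. ln (\<eta> \<zeta>))"
proof -
  obtain M where M: "0 \<le> M" "AE \<zeta> in circle_measure. norm (\<eta> \<zeta>) \<le> M"
    using Linf_norm_finite[OF assms(1)] by metis
  have [measurable]: "\<eta> \<in> borel_measurable circle_measure" using assms(1) by (simp add: in_Linf_def)
  have [measurable]: "elog \<in> borel_measurable borel" unfolding elog_def by measurable
  have "(\<integral>\<^sup>+\<zeta>. e2ennreal (elog (\<eta> \<zeta>)) \<partial>circle_measure) \<le> (\<integral>\<^sup>+\<zeta>. ennreal M \<partial>circle_measure)"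
  proof (rule nn_integral_mono_AE)
    show "AE \<zeta> in circle_measure. e2ennreal (elog (\<eta> \<zeta>)) \<le> ennreal M"
      using M(2)
    proof eventually_elim
      case (elim \<zeta>)
      show ?case
      proof (cases "0 < \<eta> \<zeta>")
        case True
        then have "ln (\<eta> \<zeta>) \<le> M" using elim ln_le_minus_one[of "\<eta> \<zeta>"] by simp
        then show ?thesis using True by (simp add: elog_def ennreal_leI)
      next
        case False
        then show ?thesis by (simp add: elog_def e2ennreal_neg)
      qed
    qed
  qed
  also have "\<dots> < \<infinity>" using circle.emeasure_space_1 by (simp add: ennreal_mult_less_top)
  finally have pos: "(\<integral>\<^sup>+\<zeta>. e2ennreal (elog (\<eta> \<zeta>)) \<partial>circle_measure) < \<infinity>" .
  have neg: "(\<integral>\<^sup>+\<zeta>. e2ennreal (- elog (\<eta> \<zeta>)) \<partial>circle_measure) \<noteq> \<infinity>"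
  proof
    assume "(\<integral>\<^sup>+\<zeta>. e2ennreal (- elog (\<eta> \<zeta>)) \<partial>circle_measure) = \<infinity>"
    moreover obtain x where "(\<integral>\<^sup>+\<zeta>. e2ennreal (elog (\<eta> \<zeta>)) \<partial>circle_measure) = ennreal x" "0 \<le> x"
      using pos by (cases "\<integral>\<^sup>+\<zeta>. e2ennreal (elog (\<eta> \<zeta>)) \<partial>circle_measure") auto
    ultimately show False using assms(2) by (simp add: extended_integral_def)
  qed
  have "AE \<zeta> in circle_measure. e2ennreal (- elog (\<eta> \<zeta>)) \<noteq> \<infinity>"
    by (rule nn_integral_PInf_AE[OF _ neg]) measurable
  then show AEpos: "AE \<zeta> in circle_measure. 0 < \<eta> \<zeta>"
    by eventually_elim (auto simp: elog_def split: if_splits)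
  show "integrable circle_measure (\<lambda>\<zeta>. ln (\<eta> \<zeta>))"
  proof (rule integrableI_bounded)
    have "(\<integral>\<^sup>+\<zeta>. ennreal (norm (ln (\<eta> \<zeta>))) \<partial>circle_measure) \<le>
        (\<integral>\<^sup>+\<zeta>. e2ennreal (elog (\<eta> \<zeta>)) + e2ennreal (- elog (\<eta> \<zeta>)) \<partial>circle_measure)"
    proof (rule nn_integral_mono_AE)
      show "AE \<zeta> in circle_measure. ennreal (norm (ln (\<eta> \<zeta>))) \<le>
          e2ennreal (elog (\<eta> \<zeta>)) + e2ennreal (- elog (\<eta> \<zeta>))"
        using AEpos by eventually_elim (auto simp: elog_def abs_if)
    qed
    also have "\<dots> = (\<integral>\<^sup>+\<zeta>. e2ennreal (elog (\<eta> \<zeta>)) \<partial>circle_measure) +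
        (\<integral>\<^sup>+\<zeta>. e2ennreal (- elog (\<eta> \<zeta>)) \<partial>circle_measure)"
      by (rule nn_integral_add) measurable
    also have "\<dots> < \<infinity>" using pos neg by (simp add: less_top)
    finally show "(\<integral>\<^sup>+\<zeta>. ennreal (norm (ln (\<eta> \<zeta>))) \<partial>circle_measure) < \<infinity>" .
  qed measurable
qed

section \<open>Outer functions\<close>

lemma outer_function_holomorphic:
  assumes "integrable circle_measure (\<lambda>\<zeta>. ln (\<eta> \<zeta>))"
  shows "outer_function \<eta> holomorphic_on ball 0 1"
proof -
  define a where "a = (\<lambda>n. (if n = 0 then 1 else 2) * (LINT \<zeta>|circle_measure. cnj \<zeta> ^ n * complex_of_real (ln (\<eta> \<zeta>))))"
  have int: "integrable circle_measure (\<lambda>\<zeta>. complex_of_real (ln (\<eta> \<zeta>)))" using assms by simp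
  have "(\<lambda>z. LINT \<zeta>|circle_measure. (\<zeta> + z) / (\<zeta> - z) * of_real (ln (\<eta> \<zeta>))) holomorphic_on ball 0 1"
  proof (rule power_series_holomorphic)
    fix z :: complex assume "z \<in> ball 0 1"
    then show "(\<lambda>n. a n * (z - 0) ^ n) sums
        (LINT \<zeta>|circle_measure. (\<zeta> + z) / (\<zeta> - z) * of_real (ln (\<eta> \<zeta>)))"
      using herglotz_integral_sums[OF int, of z] by (simp add: a_def)
  qed
  then show ?thesis unfolding outer_function_def by (intro holomorphic_intros)
qed

lemma cmod_outer_function:
  assumes "integrable circle_measure (\<lambda>\<zeta>. ln (\<eta> \<zeta>))" "cmod z < 1"
  shows "cmod (outer_function \<eta> z) = exp (poisson_integral (\<lambda>\<zeta>. ln (\<eta> \<zeta>)) z)"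
  unfolding outer_function_def norm_exp_eq_Re poisson_integral_herglotz[OF assms] ..

text \<open>Along a common subsequence of radii the Poisson integral of \<open>f\<close> tends to \<open>f\<close> and that of
  \<open>log \<eta>\<close> tends to \<open>log \<eta>\<close>, while inside the disc the modulus of the first is the exponential
  of the second.\<close>
lemma outer_function_boundary_modulus:
  assumes log: "integrable circle_measure (\<lambda>\<zeta>. ln (\<eta> \<zeta>))" and pos: "AE \<zeta> in circle_measure. 0 < \<eta> \<zeta>"
    and f: "integrable circle_measure f"
    and outer: "\<And>z. cmod z < 1 \<Longrightarrow> poisson_integral f z = outer_function \<eta> z"
  shows "AE \<zeta> in circle_measure. cmod (f \<zeta>) = \<eta> \<zeta>"
proof -
  obtain r :: "nat \<Rightarrow> real" where r: "\<And>n. 0 \<le> r n" "\<And>n. r n < 1" and rlim: "r \<longlonglongrightarrow> 1"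
    using radii_tending_to_1 by metis
  obtain s where s: "strict_mono s"
    "AE \<xi> in circle_measure. (\<lambda>n. poisson_integral f (of_real (r (s n)) * \<xi>)) \<longlonglongrightarrow> f \<xi>"
    using poisson_integral_radial_AE_subseq[OF r rlim f] .
  have rslim: "(\<lambda>n. r (s n)) \<longlonglongrightarrow> 1"
    using LIMSEQ_subseq_LIMSEQ[OF rlim s(1)] by (simp add: o_def)
  obtain t where t: "strict_mono t" "AE \<xi> in circle_measure.
      (\<lambda>n. poisson_integral (\<lambda>\<zeta>. ln (\<eta> \<zeta>)) (of_real (r (s (t n))) * \<xi>)) \<longlonglongrightarrow> ln (\<eta> \<xi>)"
    using poisson_integral_radial_AE_subseq[of "\<lambda>n. r (s n)", OF r rslim log] .
  show ?thesis
    using s(2) t(2) pos AE_circle_sphere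
  proof eventually_elim
    case (elim \<xi>)
    have "(\<lambda>n. cmod (poisson_integral f (of_real (r (s (t n))) * \<xi>))) \<longlonglongrightarrow> cmod (f \<xi>)"
      using LIMSEQ_subseq_LIMSEQ[OF elim(1) t(1)] by (intro tendsto_norm) (simp add: o_def)
    moreover have "cmod (poisson_integral f (of_real (r (s (t n))) * \<xi>)) =
        exp (poisson_integral (\<lambda>\<zeta>. ln (\<eta> \<zeta>)) (of_real (r (s (t n))) * \<xi>))" for n
    proof -
      have "cmod (of_real (r (s (t n))) * \<xi>) < 1" using r elim(4) by (simp add: norm_mult)
      then show ?thesis using outer cmod_outer_function[OF log] by simp
    qed
    moreover have "(\<lambda>n. exp (poisson_integral (\<lambda>\<zeta>. ln (\<eta> \<zeta>)) (of_real (r (s (t n))) * \<xi>))) \<longlonglongrightarrow> exp (ln (\<eta> \<xi>))"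
      using elim(2) by (rule tendsto_exp)
    ultimately have "cmod (f \<xi>) = exp (ln (\<eta> \<xi>))" using LIMSEQ_unique by simp
    then show ?case using elim(3) by simp
  qed
qed

section \<open>Garsia norm and extremality\<close>

text \<open>The variance of \<open>g\<close> with respect to the Poisson kernel is nonnegative: integrate
  \<open>2 * c * g - c\<^sup>2 \<le> g\<^sup>2\<close> with \<open>c\<close> the mean.\<close>
lemma poisson_integral_square_le:
  fixes g :: "complex \<Rightarrow> real"
  assumes g: "integrable circle_measure g" "integrable circle_measure (\<lambda>\<zeta>. (g \<zeta>)\<^sup>2)" and z: "cmod z < 1"
  shows "(poisson_integral g z)\<^sup>2 \<le> poisson_integral (\<lambda>\<zeta>. (g \<zeta>)\<^sup>2) z"
proof -
  define c where "c = poisson_integral g z"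
  have cg: "integrable circle_measure (\<lambda>\<zeta>. g \<zeta> *\<^sub>R (2 * c))" using g(1) by simp
  have "c\<^sup>2 = poisson_integral (\<lambda>\<zeta>. g \<zeta> *\<^sub>R (2 * c)) z - poisson_integral (\<lambda>_. c\<^sup>2) z"
    using z g(1) by (simp only: poisson_integral_scaleR_left poisson_integral_const)
      (simp add: c_def power2_eq_square)
  also have "\<dots> = poisson_integral (\<lambda>\<zeta>. g \<zeta> *\<^sub>R (2 * c) - c\<^sup>2) z"
    using z cg by (intro poisson_integral_diff[symmetric]) auto
  also have "\<dots> \<le> poisson_integral (\<lambda>\<zeta>. (g \<zeta>)\<^sup>2) z"
  proof (rule poisson_integral_mono)
    have "g \<zeta> *\<^sub>R (2 * c) - c\<^sup>2 \<le> (g \<zeta>)\<^sup>2" for \<zeta>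
      using zero_le_power2[of "g \<zeta> - c"] by (simp add: power2_eq_square algebra_simps)
    then show "AE \<zeta> in circle_measure. g \<zeta> *\<^sub>R (2 * c) - c\<^sup>2 \<le> (g \<zeta>)\<^sup>2" by simp
  qed (use g z in auto)
  finally show ?thesis by (simp add: c_def)
qed

text \<open>The outer function is bounded by the essential supremum of \<open>\<eta>\<close>, because the Poisson
  integral of \<open>log \<eta>\<close> is at most the logarithm of that bound.\<close>
lemma outer_function_boundary_function:
  assumes \<eta>: "in_Linf \<eta>" and log: "integrable circle_measure (\<lambda>\<zeta>. ln (\<eta> \<zeta>))"
    and pos: "AE \<zeta> in circle_measure. 0 < \<eta> \<zeta>"
  obtains f where "boundary_function_of f (outer_function \<eta>)"
proof -
  obtain M where M: "AE \<zeta> in circle_measure. norm (\<eta> \<zeta>) \<le> M"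
    using Linf_norm_finite[OF \<eta>] by metis
  have hol: "outer_function \<eta> holomorphic_on ball 0 1"
    using log by (rule outer_function_holomorphic)
  have "cmod (outer_function \<eta> z) \<le> exp (ln M)" if z: "cmod z < 1" for z
  proof -
    have "poisson_integral (\<lambda>\<zeta>. ln (\<eta> \<zeta>)) z \<le> poisson_integral (\<lambda>_. ln M) z"
    proof (rule poisson_integral_mono)
      show "AE \<zeta> in circle_measure. ln (\<eta> \<zeta>) \<le> ln M"
        using pos M by eventually_elim simp
    qed (use log z in auto)
    then show ?thesis using z by (simp add: cmod_outer_function[OF log] poisson_integral_const)
  qed
  from bounded_holomorphic_boundary_function[OF hol this] obtain f where
    f: "f \<in> borel_measurable circle_measure" "AE \<zeta> in circle_measure. cmod (f \<zeta>) \<le> exp (ln M)"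
      "\<And>z. cmod z < 1 \<Longrightarrow> poisson_integral f z = outer_function \<eta> z"
    by metis
  have "poisson_integral f holomorphic_on ball 0 1"
    using hol by (rule holomorphic_transform) (simp add: f(3))
  moreover have "in_Linf f" using f(1,2) by (rule in_LinfI)
  ultimately have "boundary_function_of f (outer_function \<eta>)"
    using f(3) by (simp add: boundary_function_of_def in_Hinf_def)
  then show ?thesis by (rule that)
qed

text \<open>With \<open>P\<close>, \<open>Q\<close>, \<open>L\<close> the Poisson integrals of \<open>\<eta>\<close>, \<open>\<eta>\<^sup>2\<close> and
  \<open>log (1/\<eta>)\<close>, and \<open>M\<close> the norm of \<open>\<eta>\<close>, the Garsia function is \<open>Q - exp (-2L)\<close>, and
  \<open>P\<^sup>2 \<le> Q \<le> M * P \<le> M\<^sup>2\<close>. Along a sequence, \<open>Q - exp (-2L)\<close> tends to its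
  upper bound \<open>M\<^sup>2\<close> exactly when \<open>P\<close> tends to \<open>M\<close> and \<open>L\<close> tends to infinity. The argument
  applies to every boundary function, since its modulus is \<open>\<eta>\<close>.\<close>
lemma outer_G_extremal_iff:
  assumes \<eta>: "in_Linf \<eta>" and pos: "AE \<zeta> in circle_measure. 0 < \<eta> \<zeta>"
    and log: "integrable circle_measure (\<lambda>\<zeta>. ln (\<eta> \<zeta>))"
    and bf: "boundary_function_of f (outer_function \<eta>)"
  shows "G_extremal f \<longleftrightarrow>
    (\<exists>z :: nat \<Rightarrow> complex. (\<forall>n. z n \<in> ball 0 1) \<and>
       (\<lambda>n. ereal (poisson_integral \<eta> (z n))) \<longlonglongrightarrow> Linf_norm \<eta> \<and>
       filterlim (\<lambda>n. poisson_integral (\<lambda>\<zeta>. ln (1 / \<eta> \<zeta>)) (z n)) at_top sequentially)"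
proof -
  have \<eta>_meas [measurable]: "\<eta> \<in> borel_measurable circle_measure" using \<eta> by (simp add: in_Linf_def)
  obtain M where M: "Linf_norm \<eta> = ereal M" "0 \<le> M" "AE \<zeta> in circle_measure. norm (\<eta> \<zeta>) \<le> M"
    using Linf_norm_finite[OF \<eta>] .
  have "AE \<zeta> in circle_measure. 0 < M" using pos M(3) by eventually_elim simp
  then have M_pos: "0 < M" by simp
  have f_Linf: "in_Linf f" and Pf: "poisson_integral f z = outer_function \<eta> z" if "cmod z < 1" for z
    using bf that by (auto simp: boundary_function_of_def in_Hinf_def)
  have f_meas [measurable]: "f \<in> borel_measurable circle_measure"
    using f_Linf[of 0] by (simp add: in_Linf_def)
  obtain B where "AE \<zeta> in circle_measure. cmod (f \<zeta>) \<le> B"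
    using Linf_norm_finite[OF f_Linf[of 0]] by auto
  then have f_int: "integrable circle_measure f" by (rule circle.integrable_const_bound) measurable
  have f_mod: "AE \<zeta> in circle_measure. cmod (f \<zeta>) = \<eta> \<zeta>"
    using log pos f_int Pf by (rule outer_function_boundary_modulus)
  have f_norm: "Linf_norm f = ereal M"
    unfolding M(1)[symmetric] using f_mod pos by (intro Linf_norm_cong) auto
  have \<eta>_le: "AE \<zeta> in circle_measure. \<eta> \<zeta> \<le> M"
    using M(3) by eventually_elim simp
  have \<eta>_int: "integrable circle_measure \<eta>"
    using M(3) by (rule circle.integrable_const_bound) measurable
  have \<eta>2_bd: "AE \<zeta> in circle_measure. (\<eta> \<zeta>)\<^sup>2 \<le> M * \<eta> \<zeta> \<and> (\<eta> \<zeta>)\<^sup>2 \<le> M\<^sup>2"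
    using M(3) pos by eventually_elim (simp add: power2_eq_square mult_mono)
  have \<eta>2_int: "integrable circle_measure (\<lambda>\<zeta>. (\<eta> \<zeta>)\<^sup>2)"
    using \<eta>2_bd by (intro circle.integrable_const_bound[where B = "M\<^sup>2"]) auto

  define P where "P = poisson_integral \<eta>"
  define Q where "Q = poisson_integral (\<lambda>\<zeta>. (\<eta> \<zeta>)\<^sup>2)"
  define L where "L = poisson_integral (\<lambda>\<zeta>. ln (1 / \<eta> \<zeta>))"
  have P_le: "P z \<le> M" if "cmod z < 1" for z
    using poisson_integral_mono[of \<eta> "\<lambda>_. M" z] that \<eta>_int \<eta>_le
    by (auto simp: P_def poisson_integral_const)
  have P_sq: "(P z)\<^sup>2 \<le> Q z" if "cmod z < 1" for z
    unfolding P_def Q_def using \<eta>_int \<eta>2_int that by (rule poisson_integral_square_le)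
  have Q_le: "Q z \<le> M * P z" if "cmod z < 1" for z
  proof -
    have "Q z \<le> poisson_integral (\<lambda>\<zeta>. \<eta> \<zeta> *\<^sub>R M) z"
      unfolding Q_def using \<eta>_int \<eta>2_int that
    proof (intro poisson_integral_mono)
      show "AE \<zeta> in circle_measure. (\<eta> \<zeta>)\<^sup>2 \<le> \<eta> \<zeta> *\<^sub>R M"
        using \<eta>2_bd by eventually_elim (simp add: mult.commute)
    qed auto
    also have "\<dots> = M * P z"
      using \<eta>_int that by (simp only: poisson_integral_scaleR_left P_def) simp
    finally show ?thesis .
  qed
  have MP_le: "M * P z \<le> M\<^sup>2" if "cmod z < 1" for z
    using P_le[OF that] M(2) by (simp add: power2_eq_square mult_left_mono)
  have cmod_f: "cmod (poisson_integral f z) = exp (- L z)" if "cmod z < 1" for z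
  proof -
    have "L z = poisson_integral (\<lambda>\<zeta>. - ln (\<eta> \<zeta>)) z"
      unfolding L_def
    proof (rule poisson_integral_cong_AE)
      show "AE \<zeta> in circle_measure. ln (1 / \<eta> \<zeta>) = - ln (\<eta> \<zeta>)"
        using pos by eventually_elim (simp add: ln_div)
    qed measurable
    also have "\<dots> = - poisson_integral (\<lambda>\<zeta>. ln (\<eta> \<zeta>)) z"
      by (simp add: poisson_integral_kernel)
    finally show ?thesis using Pf[OF that] cmod_outer_function[OF log that] by simp
  qed
  have Phi: "garsia_Phi f z = Q z - (exp (- L z))\<^sup>2" if "cmod z < 1" for z
  proof -
    have "poisson_integral (\<lambda>\<zeta>. (cmod (f \<zeta>))\<^sup>2) z = Q z"
      unfolding Q_def
    proof (rule poisson_integral_cong_AE)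
      show "AE \<zeta> in circle_measure. (cmod (f \<zeta>))\<^sup>2 = (\<eta> \<zeta>)\<^sup>2"
        using f_mod by eventually_elim simp
    qed measurable
    then show ?thesis using cmod_f[OF that] by (simp add: garsia_Phi_def)
  qed
  have Phi_le: "garsia_Phi f z \<le> Q z" if "cmod z < 1" for z
    using Phi[OF that] by simp
  have sqrt_le: "sqrt (garsia_Phi f z) \<le> M" if "cmod z < 1" for z
    using Phi_le[OF that] Q_le[OF that] MP_le[OF that] M(2) by (intro real_le_lsqrt) auto

  show ?thesis
  proof
    assume "G_extremal f"
    then have SUP: "(SUP z\<in>ball 0 1. ereal (sqrt (garsia_Phi f z))) = ereal M"
      using f_norm by (simp add: G_extremal_def garsia_norm_def)
    have "\<exists>z. cmod z < 1 \<and> M - 1 / real (Suc n) < sqrt (garsia_Phi f z)" for n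
    proof -
      have "ereal (M - 1 / real (Suc n)) < (SUP z\<in>ball 0 1. ereal (sqrt (garsia_Phi f z)))"
        unfolding SUP by simp
      then show ?thesis unfolding less_SUP_iff by auto
    qed
    then obtain z where z: "\<And>n. cmod (z n) < 1"
      and zM: "\<And>n. M - 1 / real (Suc n) < sqrt (garsia_Phi f (z n))"
      by metis
    have lower: "(\<lambda>n. M - 1 / real (Suc n)) \<longlonglongrightarrow> M" by real_asymp
    have "(\<lambda>n. sqrt (garsia_Phi f (z n))) \<longlonglongrightarrow> M"
      by (rule tendsto_sandwich[OF _ _ lower tendsto_const]) (intro always_eventually allI less_imp_le[OF zM] sqrt_le[OF z])+
    then have "(\<lambda>n. (sqrt (garsia_Phi f (z n)))\<^sup>2) \<longlonglongrightarrow> M\<^sup>2" by (rule tendsto_power)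
    moreover have "\<forall>\<^sub>F n in sequentially. (sqrt (garsia_Phi f (z n)))\<^sup>2 = garsia_Phi f (z n)"
      using order_tendstoD(1)[OF lower M_pos]
    proof eventually_elim
      case (elim n)
      then have "0 < sqrt (garsia_Phi f (z n))" using zM[of n] by linarith
      then show ?case by simp
    qed
    ultimately have Phi_lim: "(\<lambda>n. garsia_Phi f (z n)) \<longlonglongrightarrow> M\<^sup>2"
      by (simp add: tendsto_cong)
    have Q_lim: "(\<lambda>n. Q (z n)) \<longlonglongrightarrow> M\<^sup>2"
      by (rule tendsto_sandwich[OF _ _ Phi_lim tendsto_const])
        (intro always_eventually allI Phi_le[OF z] order_trans[OF Q_le[OF z] MP_le[OF z]])+
    have "(\<lambda>n. M * P (z n)) \<longlonglongrightarrow> M\<^sup>2"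
      by (rule tendsto_sandwich[OF _ _ Q_lim tendsto_const]) (intro always_eventually allI Q_le[OF z] MP_le[OF z])+
    then have "(\<lambda>n. M * P (z n) / M) \<longlonglongrightarrow> M\<^sup>2 / M"
      using M_pos by (intro tendsto_divide tendsto_const) auto
    then have P_lim: "(\<lambda>n. P (z n)) \<longlonglongrightarrow> M"
      using M_pos by (simp add: power2_eq_square)
    have "(\<lambda>n. Q (z n) - garsia_Phi f (z n)) \<longlonglongrightarrow> M\<^sup>2 - M\<^sup>2"
      using Q_lim Phi_lim by (rule tendsto_diff)
    then have exp_lim: "(\<lambda>n. (exp (- L (z n)))\<^sup>2) \<longlonglongrightarrow> 0"
      using z Phi by simp
    have L_lim: "filterlim (\<lambda>n. L (z n)) at_top sequentially"
      unfolding filterlim_at_top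
    proof
      fix C
      have "\<forall>\<^sub>F n in sequentially. (exp (- L (z n)))\<^sup>2 < (exp (- C))\<^sup>2"
        by (rule order_tendstoD(2)[OF exp_lim]) simp
      then show "\<forall>\<^sub>F n in sequentially. C \<le> L (z n)"
        by eventually_elim (auto dest: power_less_imp_less_base)
    qed
    show "\<exists>z :: nat \<Rightarrow> complex. (\<forall>n. z n \<in> ball 0 1) \<and>
       (\<lambda>n. ereal (poisson_integral \<eta> (z n))) \<longlonglongrightarrow> Linf_norm \<eta> \<and>
       filterlim (\<lambda>n. poisson_integral (\<lambda>\<zeta>. ln (1 / \<eta> \<zeta>)) (z n)) at_top sequentially"
      using z P_lim L_lim unfolding M(1) P_def L_def by (intro exI[of _ z]) auto
  next
    assume "\<exists>z :: nat \<Rightarrow> complex. (\<forall>n. z n \<in> ball 0 1) \<and>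
       (\<lambda>n. ereal (poisson_integral \<eta> (z n))) \<longlonglongrightarrow> Linf_norm \<eta> \<and>
       filterlim (\<lambda>n. poisson_integral (\<lambda>\<zeta>. ln (1 / \<eta> \<zeta>)) (z n)) at_top sequentially"
    then obtain z where z: "\<And>n. cmod (z n) < 1" and P_lim: "(\<lambda>n. P (z n)) \<longlonglongrightarrow> M"
      and L_lim: "filterlim (\<lambda>n. L (z n)) at_top sequentially"
      unfolding M(1) P_def L_def by auto
    have P_sq_lim: "(\<lambda>n. (P (z n))\<^sup>2) \<longlonglongrightarrow> M\<^sup>2" using P_lim by (rule tendsto_power)
    have Q_lim: "(\<lambda>n. Q (z n)) \<longlonglongrightarrow> M\<^sup>2"
      by (rule tendsto_sandwich[OF _ _ P_sq_lim tendsto_const])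
        (intro always_eventually allI P_sq[OF z] order_trans[OF Q_le[OF z] MP_le[OF z]])+
    have "(\<lambda>n. exp (- L (z n))) \<longlonglongrightarrow> 0"
      using L_lim by (intro filterlim_compose[OF exp_at_bot] filterlim_compose[OF filterlim_uminus_at_bot_at_top])
    then have "(\<lambda>n. Q (z n) - (exp (- L (z n)))\<^sup>2) \<longlonglongrightarrow> M\<^sup>2 - 0\<^sup>2"
      by (intro tendsto_intros Q_lim)
    then have "(\<lambda>n. garsia_Phi f (z n)) \<longlonglongrightarrow> M\<^sup>2" using z Phi by simp
    then have "(\<lambda>n. sqrt (garsia_Phi f (z n))) \<longlonglongrightarrow> sqrt (M\<^sup>2)" by (rule tendsto_real_sqrt)
    then have sqrt_lim: "(\<lambda>n. ereal (sqrt (garsia_Phi f (z n)))) \<longlonglongrightarrow> ereal M"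
      using M(2) by simp
    have "ereal (sqrt (garsia_Phi f (z n))) \<le> garsia_norm f" for n
      unfolding garsia_norm_def by (rule SUP_upper) (simp add: z)
    then have "ereal M \<le> garsia_norm f"
      by (intro LIMSEQ_le_const2[OF sqrt_lim]) blast
    moreover have "garsia_norm f \<le> ereal M"
      unfolding garsia_norm_def using sqrt_le by (intro SUP_least) auto
    ultimately show "G_extremal f"
      using f_norm f_Linf[of 0] by (simp add: G_extremal_def)
  qed
qed

theorem theorem2p4:
  fixes \<eta> :: "complex \<Rightarrow> real"
  assumes "in_Linf \<eta>"
    and "AE \<zeta> in circle_measure. 0 \<le> \<eta> \<zeta>"
    and "extended_integral circle_measure (\<lambda>\<zeta>. elog (\<eta> \<zeta>)) > -\<infinity>"
  shows "G_extremal_disc (outer_function \<eta>) \<longleftrightarrow>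
    (\<exists>z :: nat \<Rightarrow> complex. (\<forall>n. z n \<in> ball 0 1) \<and>
       (\<lambda>n. ereal (poisson_integral \<eta> (z n))) \<longlonglongrightarrow> Linf_norm \<eta> \<and>
       filterlim (\<lambda>n. poisson_integral (\<lambda>\<zeta>. ln (1 / \<eta> \<zeta>)) (z n)) at_top sequentially)"
proof -
  note log = log_integrable_circle[OF assms(1,3)]
  obtain f where "boundary_function_of f (outer_function \<eta>)"
    using outer_function_boundary_function[OF assms(1) log(2,1)] .
  then show ?thesis
    unfolding G_extremal_disc_def using outer_G_extremal_iff[OF assms(1) log] by blast
qed

end
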